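(* Let $\ell\in\frac12\mathbb{N}$. The sequence of monic matrix polynomials $\{P_d(x)\}_{d\ge 0}$ obtained from the full spherical functions of type $\ell$ is orthogonal with respect to the matrix-valued inner product $$\langle P,Q\rangle=\int_{-1}^1P(x)W(x)Q(x)^*\,dx,$$ i.e. $\langle P_d,P_{d'}\rangle=0$ for $d\neq d'$.
   Context: $\mathbb{N}=\{0,1,2,\dots\}$. $K=\mathrm{SU}(2)$, $U=K\times K$. $m_t=\mathrm{diag}(e^{it/2},e^{-it/2})$, $a_t=(m_t,m_{-t})$, $A_*=\{a_t:0\le t<4\pi\}$. For $\ell\in\frac12\mathbb{N}$, $H^\ell=\mathbb{C}[x,y]_{2\ell}$ with $K$ acting by $T^\ell(k)p=p\circ k^t$ and orthonormal basis $\psi^\ell_j=\binom{2\ell}{\ell-j}^{1/2}x^{\ell-j}y^{\ell+j}$, $j=-\ell,\dots,\ell$; endomorphisms are written as matrices in this basis. For $(\ell_1,\ell_2)$ with $|\ell_1-\ell_2|\le\ell\le\ell_1+\ell_2$, $\ell_1+\ell_2-\ell\in\mathbb{Z}$, let $\beta^{\ell_1,\ell_2}_\ell:H^\ell\to H^{\ell_1}\otimes H^{\ell_2}$, $\psi^\ell_j\mapsto\sum_{j_1,j_2}C^{\ell_1,\ell_2,\ell}_{j_1,j_2,j}\psi^{\ell_1}_{j_1}\otimes\psi^{\ell_2}_{j_2}$ ($C$ = standard Clebsch-Gordan coefficients), and $\Phi^\ell_{\ell_1,\ell_2}(x)=(\beta^{\ell_1,\ell_2}_\ell)^*\circ T^{\ell_1,\ell_2}(x)\circ\beta^{\ell_1,\ell_2}_\ell$,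 with $T^{\ell_1,\ell_2}$ the outer tensor product representation of $U$. On $A_*$ it is diagonal with $(\Phi^\ell_{\ell_1,\ell_2}(a_t))_{j,j}=\sum_{j_1,j_2}e^{i(j_2-j_1)t}(C^{\ell_1,\ell_2,\ell}_{j_1,j_2,j})^2$. With $\zeta(d,k)=\left(\frac{d+\ell+k}{2},\frac{d+\ell-k}{2}\right)$, the full spherical function of degree $d\in\mathbb{N}$ is $(\Phi^\ell_d(a))_{p,q}=(\Phi^\ell_{\zeta(d,p)}(a))_{q,q}$, $p,q\in\{-\ell,\dots,\ell\}$. $\Phi^\ell_0(a_t)$ is invertible for $t\notin\pi\mathbb{Z}$, and $Q_d(a_t)=\Phi^\ell_d(a_t)\Phi^\ell_0(a_t)^{-1}$ is a matrix polynomial in $x=\cos t$ of degree $d$ with nonsingular leading coefficient $\Upsilon_d$. Relabeling rows and columns from $\{-\ell,\dots,\ell\}$ to $\{0,\dots,2\ell\}$ via $n\mapsto-\ell+n$, put $P_d(x)=\Upsilon_d^{-1}Q_d(a_{\arccos x})$, a monic matrix polynomial of degree $d$. The weight $W$ on $(-1,1)$ is defined by $\sqrt{1-x^2}\,W(x)_{n,m}=V(a_{\arccos x})_{-\ell+n,-\ell+m}$, $n,m\in\{0,\dots,2\ell\}$, where $V(a_t)=\Phi^\ell_0(a_t)\left(\Phi^\ell_0(a_t)\right)^*\sin^2t$. *)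

theory Defs
  imports
    "HOL-Analysis.Analysis"
    "Jordan_Normal_Form.Schur_Decomposition"
begin

text \<open>
  Spins are encoded by their doubles: a natural number \<open>L\<close> stands for the spin
  \<open>\<ell> = L / 2\<close>, and a weight \<open>j \<in> {-\<ell>, \<dots>, \<ell>}\<close> is encoded by
  \<open>n = \<ell> + j \<in> {0, \<dots>, L}\<close>, so that \<open>\<ell> - j = L - n\<close>.
  Hence rows and columns are labelled by \<open>0, \<dots>, 2\<ell>\<close> throughout.
\<close>

subsection \<open>The representations of SU(2)\<close>

text \<open>
  Elements of \<open>\<complex>[x,y]\<close>, homogeneous of degree \<open>L\<close>, are regarded as functions
  of \<open>v = (x, y)\<close>.
\<close>

definition psi :: "nat \<Rightarrow> nat \<Rightarrow> complex Matrix.vec \<Rightarrow> complex" where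
  "psi L n v = complex_of_real (sqrt (real (L choose (L - n))))
      * vec_index v 0 ^ (L - n) * vec_index v 1 ^ n"

definition act :: "complex Matrix.mat \<Rightarrow> (complex Matrix.vec \<Rightarrow> complex)
    \<Rightarrow> complex Matrix.vec \<Rightarrow> complex" where
  "act k p = (\<lambda>v. p (transpose_mat k *\<^sub>v v))"

text \<open>
  The matrix of \<open>T\<^sup>\<ell>(k)\<close> in the basis \<open>psi L 0, \<dots>, psi L L\<close>.  The
  description makes sense for every complex \<open>2 \<times> 2\<close> matrix \<open>k\<close>, in particular
  on \<open>SU(2)\<close>.
\<close>

definition T_rep :: "nat \<Rightarrow> complex Matrix.mat \<Rightarrow> complex Matrix.mat" where
  "T_rep L k = (THE A. A \<in> carrier_mat (L + 1) (L + 1) \<and>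
     (\<forall>n\<le>L. \<forall>v\<in>carrier_vec 2. act k (psi L n) v = (\<Sum>m\<le>L. A $$ (m, n) * psi L m v)))"

subsection \<open>Clebsch-Gordan coefficients\<close>

text \<open>
  Racah's formula for \<open>C\<^bsup>\<ell>1,\<ell>2,\<ell>\<^esup>\<close> at \<open>(j\<^sub>1, j\<^sub>2, j)\<close> with the Condon-Shortley
  phase convention, for \<open>\<bar>\<ell>\<^sub>1 - \<ell>\<^sub>2\<bar> \<le> \<ell> \<le> \<ell>\<^sub>1 + \<ell>\<^sub>2\<close> and
  \<open>\<ell>\<^sub>1 + \<ell>\<^sub>2 - \<ell>\<close> an integer.
  Here \<open>s = \<ell>\<^sub>1 + \<ell>\<^sub>2 - \<ell>\<close>, \<open>a = \<ell> + \<ell>\<^sub>1 - \<ell>\<^sub>2\<close>,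
  \<open>b = \<ell> - \<ell>\<^sub>1 + \<ell>\<^sub>2\<close>; the condition \<open>j\<^sub>1 + j\<^sub>2 = j\<close> reads
  \<open>n\<^sub>1 + n\<^sub>2 = n + s\<close>, and in the textbook denominator
  \<open>\<ell> - \<ell>\<^sub>2 + j\<^sub>1 + k = n\<^sub>1 + k - s\<close> and
  \<open>\<ell> - \<ell>\<^sub>1 - j\<^sub>2 + k = b + k - n\<^sub>2\<close>.  The sum runs over
  those \<open>k\<close> for which no argument of a factorial is negative.
\<close>

definition clebsch_gordan :: "nat \<Rightarrow> nat \<Rightarrow> nat \<Rightarrow> nat \<Rightarrow> nat \<Rightarrow> nat \<Rightarrow> real" where
  "clebsch_gordan L1 L2 L n1 n2 n =
    (let s = (L1 + L2 - L) div 2; a = (L + L1 - L2) div 2; b = (L + L2 - L1) div 2 in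
     if n1 + n2 = n + s then
       sqrt (real (L + 1) * fact a * fact b * fact s / fact ((L1 + L2 + L) div 2 + 1))
       * sqrt (fact n * fact (L - n) * fact n1 * fact (L1 - n1) * fact n2 * fact (L2 - n2))
       * (\<Sum>k | k \<le> s \<and> k \<le> L1 - n1 \<and> k \<le> n2 \<and> s \<le> n1 + k \<and> n2 \<le> b + k.
            (-1) ^ k / (fact k * fact (s - k) * fact (L1 - n1 - k) * fact (n2 - k)
                        * fact (n1 + k - s) * fact (b + k - n2)))
     else 0)"

subsection \<open>Spherical functions on \<open>U = SU(2) \<times> SU(2)\<close>\<close>

text \<open>
  The matrix coefficient of \<open>\<beta>\<close> at the basis vectors
  \<open>psi L1 n1 \<otimes> psi L2 n2\<close> and \<open>psi L n\<close>.
\<close>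

definition beta :: "nat \<Rightarrow> nat \<Rightarrow> nat \<Rightarrow> nat \<times> nat \<Rightarrow> nat \<Rightarrow> complex" where
  "beta L1 L2 L = (\<lambda>(n1, n2) n. complex_of_real (clebsch_gordan L1 L2 L n1 n2 n))"

text \<open>
  \<open>\<beta>\<^sup>* \<circ> (T(k1) \<otimes> T(k2)) \<circ> \<beta>\<close>, the tensor product being
  indexed by pairs; all bases are orthonormal, so \<open>\<beta>\<^sup>*\<close> is the conjugate transpose.
\<close>

definition Phi :: "nat \<Rightarrow> nat \<Rightarrow> nat \<Rightarrow> complex Matrix.mat \<times> complex Matrix.mat
    \<Rightarrow> complex Matrix.mat" where
  "Phi L L1 L2 = (\<lambda>(k1, k2). Matrix.mat (L + 1) (L + 1) (\<lambda>(p, q).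
     \<Sum>(m1, m2) \<in> {..L1} \<times> {..L2}. \<Sum>(n1, n2) \<in> {..L1} \<times> {..L2}.
       cnj (beta L1 L2 L (m1, m2) p)
       * (T_rep L1 k1 $$ (m1, n1) * T_rep L2 k2 $$ (m2, n2))
       * beta L1 L2 L (n1, n2) q))"

definition m_elt :: "real \<Rightarrow> complex Matrix.mat" where
  "m_elt t = mat_of_rows_list 2 [[exp (\<i> * of_real t / 2), 0], [0, exp (- \<i> * of_real t / 2)]]"

definition a_elt :: "real \<Rightarrow> complex Matrix.mat \<times> complex Matrix.mat" where
  "a_elt t = (m_elt t, m_elt (- t))"

text \<open>
  For the label \<open>p = \<ell> + k\<close>, \<open>\<zeta>(d,k) = ((d+\<ell>+k)/2, (d+\<ell>-k)/2)\<close> is the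
  pair of spins with doubles \<open>d + \<ell> + k = d + p\<close> and \<open>d + \<ell> - k = d + (L - p)\<close>.
\<close>

definition zeta :: "nat \<Rightarrow> nat \<Rightarrow> nat \<Rightarrow> nat \<times> nat" where
  "zeta L d p = (d + p, d + (L - p))"

definition full_spherical :: "nat \<Rightarrow> nat \<Rightarrow> complex Matrix.mat \<times> complex Matrix.mat
    \<Rightarrow> complex Matrix.mat" where
  "full_spherical L d x = Matrix.mat (L + 1) (L + 1) (\<lambda>(p, q).
     Phi L (fst (zeta L d p)) (snd (zeta L d p)) x $$ (q, q))"

subsection \<open>The matrix polynomials and the weight\<close>

text \<open>The inverse of a nonsingular matrix, by Cramer's rule.\<close>

definition minv :: "complex Matrix.mat \<Rightarrow> complex Matrix.mat" where
  "minv A = inverse (Determinant.det A) \<cdot>\<^sub>m adj_mat A"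

lemma minv:
  assumes "A \<in> carrier_mat n n" "Determinant.det A \<noteq> 0"
  shows "minv A \<in> carrier_mat n n" "A * minv A = 1\<^sub>m n" "minv A * A = 1\<^sub>m n"
proof -
  note a = adj_mat[OF assms(1)]
  show "minv A \<in> carrier_mat n n"
    using a(1) by (simp add: minv_def)
  show "A * minv A = 1\<^sub>m n"
    using assms a by (auto simp: minv_def mult_smult_distrib[OF assms(1) a(1)])
  show "minv A * A = 1\<^sub>m n"
    using assms a by (auto simp: minv_def mult_smult_assoc_mat[OF a(1) assms(1)])
qed

definition Q_fun :: "nat \<Rightarrow> nat \<Rightarrow> real \<Rightarrow> complex Matrix.mat" where
  "Q_fun L d t = full_spherical L d (a_elt t) * minv (full_spherical L 0 (a_elt t))"

text \<open>
  \<open>Q\<^sub>d\<close> as a matrix with entries in \<open>\<complex>[x]\<close>, \<open>x = cos t\<close>: the polynomials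
  are determined by their values at \<open>cos t\<close> for \<open>t \<notin> \<pi>\<int>\<close>.
\<close>

definition Q_poly :: "nat \<Rightarrow> nat \<Rightarrow> complex poly Matrix.mat" where
  "Q_poly L d = Matrix.mat (L + 1) (L + 1) (\<lambda>(n, m).
     THE q. \<forall>t. sin t \<noteq> 0 \<longrightarrow> poly q (complex_of_real (cos t)) = Q_fun L d t $$ (n, m))"

text \<open>The leading coefficient, i.e. the coefficient of \<open>x\<^sup>d\<close>, \<open>Q\<^sub>d\<close> being of degree \<open>d\<close>.\<close>

definition Upsilon :: "nat \<Rightarrow> nat \<Rightarrow> complex Matrix.mat" where
  "Upsilon L d = map_mat (\<lambda>q. poly.coeff q d) (Q_poly L d)"

definition P_monic :: "nat \<Rightarrow> nat \<Rightarrow> real \<Rightarrow> complex Matrix.mat" where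
  "P_monic L d x = minv (Upsilon L d) * Q_fun L d (arccos x)"

definition V_weight :: "nat \<Rightarrow> real \<Rightarrow> complex Matrix.mat" where
  "V_weight L t = complex_of_real ((sin t)\<^sup>2) \<cdot>\<^sub>m
     (full_spherical L 0 (a_elt t) * mat_adjoint (full_spherical L 0 (a_elt t)))"

definition W_weight :: "nat \<Rightarrow> real \<Rightarrow> complex Matrix.mat" where
  "W_weight L x = complex_of_real (1 / sqrt (1 - x\<^sup>2)) \<cdot>\<^sub>m V_weight L (arccos x)"

definition ip_integrand :: "nat \<Rightarrow> (real \<Rightarrow> complex Matrix.mat) \<Rightarrow> (real \<Rightarrow> complex Matrix.mat)
    \<Rightarrow> real \<Rightarrow> complex Matrix.mat" where
  "ip_integrand L P Q x = P x * W_weight L x * mat_adjoint (Q x)"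

definition matrix_ip :: "nat \<Rightarrow> (real \<Rightarrow> complex Matrix.mat) \<Rightarrow> (real \<Rightarrow> complex Matrix.mat)
    \<Rightarrow> complex Matrix.mat" where
  "matrix_ip L P Q = Matrix.mat (L + 1) (L + 1) (\<lambda>(n, m).
     LBINT x:{-1<..<1}. ip_integrand L P Q x $$ (n, m))"

end

theory Submission
  imports Defs
begin

text \<open>
  With spins doubled, the row of \<open>\<Phi>\<^sub>d\<close> with label \<open>p\<close> belongs to the tensor product of spins
  \<open>a + s\<close> and \<open>b + s\<close>, where \<open>a = p\<close>, \<open>b = L - p\<close> and \<open>s = d\<close>; it contains the spin
  \<open>L = a + b\<close>.  Since \<open>W\<close> is \<open>\<Phi>\<^sub>0 \<Phi>\<^sub>0\<^sup>*\<close> times a scalar and \<open>\<Phi>\<^sub>0(a\<^sub>t)\<close> is invertible when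
  \<open>sin t \<noteq> 0\<close> (\<open>det_full_spherical_0\<close>), the factors \<open>\<Phi>\<^sub>0\<close> cancel: the inner product is,
  between two constant matrices, the integral of \<open>\<Phi>\<^sub>d(a\<^sub>t) \<Phi>\<^sub>d\<^sub>'(a\<^sub>t)\<^sup>* sin\<^sup>2 t\<close> over \<open>(0, \<pi>)\<close>.
  The leading coefficients only enter as constant matrices.

  Write \<open>D(i, q)\<close> for the squared Clebsch-Gordan coefficient at the weight \<open>i\<close> of the first factor
  and the weight \<open>q\<close> of spin \<open>L\<close>.  Since \<open>a\<^sub>t = (m\<^sub>2\<^sub>t, 1) (m\<^sub>-\<^sub>t, m\<^sub>-\<^sub>t)\<close> and the diagonal
  subgroup is intertwined by \<open>\<beta>\<close>, the entry of \<open>\<Phi>\<^sub>d(a\<^sub>t)\<close> at \<open>q\<close> is a phase, depending on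
  \<open>q\<close> and the spins, times \<open>\<Sum>\<^sub>i D(i, q) cis (- 2 i t)\<close>.
  In the product with the conjugate of another row the dependence of the phase on \<open>q\<close> cancels, and what matters
  are the numbers \<open>\<Sum>\<^sub>q D(i, q) D'(i', q)\<close>, weighted by integrals of
  \<open>cis (k t) sin\<^sup>2 t\<close> with \<open>k = N - N' - 2 i + 2 i'\<close>, where \<open>N\<close> and \<open>N'\<close> are the first spins of the two rows.
  If \<open>d \<noteq> d'\<close>, then the first spins of the two rows differ or the second ones do; swapping the
  factors conjugates the entries, so assume \<open>N < N'\<close>.

  If \<open>N' - N\<close> is odd, all \<open>k\<close> are odd, the integrals are odd in \<open>k\<close>, and the reflection of all
  weights makes the sum vanish.  If \<open>N' - N = 2 (c + 1)\<close>, only \<open>k = 0\<close> and \<open>k = \<plusminus>2\<close>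
  contribute, and the claim is that \<open>\<Sum>\<^sub>q\<^sub>,\<^sub>i D(i, q) D'(i + e, q)\<close> has the same value for
  \<open>e = c\<close>, \<open>c + 1\<close> and \<open>c + 2\<close>.

  The difference of two such values is the trace of an operator on functions of \<open>q\<close>: apply
  \<open>D'\<close>, take a shifted difference, apply the transpose of \<open>D\<close>.  Each of \<open>D'\<close> and the
  transpose of \<open>D\<close> maps polynomials of degree less than \<open>m\<close> to such polynomials
  (\<open>average_degree\<close>, \<open>dual_average_degree\<close>; this is the Wigner-Eckart theorem for
  functions of the weight), whereas the difference lowers the degree.  Hence the operator is
  strictly triangular and its trace is zero (\<open>trace_shift\<close>).  The preservation of degree
  follows from the intertwining property of the Clebsch-Gordan coefficients, which for Racah's sum
  is a pair of three-term recurrences (\<open>racah_lower\<close>, \<open>racah_raise\<close>).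
\<close>

section \<open>Racah's sum\<close>

text \<open>
  The entire function \<open>1 / \<Gamma>(m + 1)\<close> at the integers.  Its zeros at the negative integers encode the
  summation range of Racah's formula, so that shifting an argument never needs a side condition.
\<close>

definition rfact :: "int \<Rightarrow> real" where
  "rfact m = (if m < 0 then 0 else 1 / fact (nat m))"

lemma rfact_neg [simp]: "m < 0 \<Longrightarrow> rfact m = 0"
  by (simp add: rfact_def)

lemma rfact_eq_0_iff [simp]: "rfact m = 0 \<longleftrightarrow> m < 0"
  by (simp add: rfact_def)

lemma rfact_of_nat [simp]: "rfact (int n) = 1 / fact n"
  by (simp add: rfact_def)

lemma rfact_pred: "of_int m * rfact m = rfact (m - 1)"
proof (cases "m \<le> 0")
  case True
  then show ?thesis by (cases "m = 0") (auto simp: rfact_def)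
next
  case False
  then obtain n where n: "m = int (Suc n)"
    by (metis not_le zero_less_imp_eq_int Suc_pred)
  have "m - 1 = int n" using n by simp
  then have "rfact (m - 1) = 1 / fact n" by simp
  then show ?thesis unfolding n rfact_of_nat by (simp add: field_simps del: of_nat_Suc)
qed

text \<open>
  Racah's sum for spins (doubled) \<open>a + s\<close>, \<open>b + s\<close> and \<open>a + b\<close>, at the weights \<open>i\<close> and
  \<open>j\<close> of the two factors.  Up to the factor \<open>a! b! s!\<close> it is the coefficient of \<open>x\<^sup>i z\<^sup>j\<close> in
  \<open>(x - z)\<^sup>s (1 + x)\<^sup>a (1 + z)\<^sup>b\<close>.
\<close>

definition racah :: "nat \<Rightarrow> nat \<Rightarrow> nat \<Rightarrow> int \<Rightarrow> int \<Rightarrow> real" where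
  "racah a b s i j = (\<Sum>k\<le>s. (-1) ^ k * (rfact (int k) * rfact (int s - int k)
     * rfact (int a + int s - i - int k) * rfact (j - int k)
     * rfact (i + int k - int s) * rfact (int b + int k - j)))"

lemma racah_eq_0:
  assumes "i < 0 \<or> i > int a + int s \<or> j < 0 \<or> j > int b + int s"
  shows "racah a b s i j = 0"
  unfolding racah_def
proof (rule sum.neutral, rule ballI)
  fix k assume "k \<in> {..s}"
  then have "int a + int s - i - int k < 0 \<or> j - int k < 0
      \<or> i + int k - int s < 0 \<or> int b + int k - j < 0"
    using assms by auto
  then show "(-1) ^ k * (rfact (int k) * rfact (int s - int k)
     * rfact (int a + int s - i - int k) * rfact (j - int k)
     * rfact (i + int k - int s) * rfact (int b + int k - j)) = 0"
    by auto
qed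

text \<open>
  The lowering operator of \<open>sl\<^sub>2\<close> commutes with the embedding \<open>\<beta>\<close>: the derivation
  \<open>\<partial>\<^sub>x + \<partial>\<^sub>z\<close> annihilates the factor \<open>(x - z)\<^sup>s\<close> of the generating function.
\<close>

lemma racah_lower:
  "of_int (i + 1) * racah a b s (i + 1) j + of_int (j + 1) * racah a b s i (j + 1)
     = of_int (int a + int b + int s - i - j) * racah a b s i j"
proof -
  define X where "X k = (-1) ^ k * (rfact (int k - 1) * rfact (int s - int k)
     * rfact (int a + int s - i - int k) * rfact (j + 1 - int k)
     * rfact (i + int k - int s) * rfact (int b + int k - 1 - j))" for k
  define t where "t i j k = (-1) ^ k * (rfact (int k) * rfact (int s - int k)
     * rfact (int a + int s - i - int k) * rfact (j - int k)
     * rfact (i + int k - int s) * rfact (int b + int k - j))" for i j k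
  have step: "of_int (int a + int b + int s - i - j) * t i j k
      - of_int (i + 1) * t (i + 1) j k - of_int (j + 1) * t i (j + 1) k = X (Suc k) - X k" for k
  proof -
    \<comment> \<open>The two parts of the coefficient move a factor from one factorial to another and so
      yield the terms of the sums on the left, up to remainders that telescope.\<close>
    have 1: "of_int (int a + int s - i - int k) * t i j k = of_int (i + 1 + int k - int s) * t (i + 1) j k"
    proof -
      have "rfact (int a + int s - (i + 1) - int k)
          = of_int (int a + int s - i - int k) * rfact (int a + int s - i - int k)"
        "rfact (i + int k - int s) = of_int (i + 1 + int k - int s) * rfact (i + 1 + int k - int s)"
        unfolding rfact_pred by (auto intro: arg_cong[where f = rfact])
      then show ?thesis unfolding t_def by (simp only: mult_ac)
    qed
    have 2: "of_int (int b + int k - j) * t i j k = of_int (j + 1 - int k) * t i (j + 1) k"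
    proof -
      have "rfact (int b + int k - (j + 1)) = of_int (int b + int k - j) * rfact (int b + int k - j)"
        "rfact (j - int k) = of_int (j + 1 - int k) * rfact (j + 1 - int k)"
        unfolding rfact_pred by (auto intro: arg_cong[where f = rfact])
      then show ?thesis unfolding t_def by (simp only: mult_ac)
    qed
    have 3: "of_int (int k) * t i (j + 1) k = X k"
    proof -
      have "rfact (int k - 1) = of_int (int k) * rfact (int k)"
        "rfact (int b + int k - 1 - j) = rfact (int b + int k - (j + 1))"
        unfolding rfact_pred by (auto intro: arg_cong[where f = rfact])
      then show ?thesis unfolding t_def X_def by (simp only: mult_ac)
    qed
    have 4: "of_int (int s - int k) * t (i + 1) j k = - X (Suc k)"
    proof -
      have "rfact (int (Suc k) - 1) = rfact (int k)"
        "rfact (int s - int (Suc k)) = of_int (int s - int k) * rfact (int s - int k)"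
        "rfact (int a + int s - i - int (Suc k)) = rfact (int a + int s - (i + 1) - int k)"
        "rfact (j + 1 - int (Suc k)) = rfact (j - int k)"
        "rfact (i + int (Suc k) - int s) = rfact (i + 1 + int k - int s)"
        "rfact (int b + int (Suc k) - 1 - j) = rfact (int b + int k - j)"
        unfolding rfact_pred by (auto intro: arg_cong[where f = rfact])
      note e = this
      show ?thesis unfolding t_def X_def e by simp
    qed
    have "of_int (int a + int b + int s - i - j) * t i j k
        = of_int (int a + int s - i - int k) * t i j k + of_int (int b + int k - j) * t i j k"
      by (simp add: algebra_simps)
    also have "\<dots> = of_int (i + 1 + int k - int s) * t (i + 1) j k + of_int (j + 1 - int k) * t i (j + 1) k"
      by (simp only: 1 2)
    also have "\<dots> = of_int (i + 1) * t (i + 1) j k - of_int (int s - int k) * t (i + 1) j k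
        + of_int (j + 1) * t i (j + 1) k - of_int (int k) * t i (j + 1) k"
      by (simp add: algebra_simps)
    finally show ?thesis unfolding 3 4 by simp
  qed
  have "(\<Sum>k\<le>s. X (Suc k) - X k) = X (Suc s) - X 0"
    by (simp add: sum_telescope[of "\<lambda>k. - X k", simplified])
  also have "\<dots> = 0" by (simp add: X_def)
  finally have "(\<Sum>k\<le>s. of_int (int a + int b + int s - i - j) * t i j k
      - of_int (i + 1) * t (i + 1) j k - of_int (j + 1) * t i (j + 1) k) = 0"
    by (simp only: step)
  moreover have "racah a b s i j = (\<Sum>k\<le>s. t i j k)" for i j
    unfolding racah_def t_def ..
  ultimately show ?thesis
    by (simp add: sum_subtractf sum_distrib_left)
qed

text \<open>
  Symmetry under the reflection of all weights, by reversal of the order of summation.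
\<close>

lemma racah_flip: "racah a b s (int a + int s - i) (int b + int s - j) = (-1) ^ s * racah a b s i j"
proof -
  have "racah a b s i j = (\<Sum>k\<le>s. (-1) ^ s * ((-1) ^ k * (rfact (int k) * rfact (int s - int k)
     * rfact (i - int k) * rfact (int b + int s - j - int k)
     * rfact (int a - i + int k) * rfact (j + int k - int s))))"
    unfolding racah_def
    by (rule sum.reindex_bij_witness[of _ "\<lambda>k. s - k" "\<lambda>k. s - k"])
       (auto simp: of_nat_diff minus_one_power_iff algebra_simps)
  also have "\<dots> = (-1) ^ s * racah a b s (int a + int s - i) (int b + int s - j)"
    unfolding racah_def sum_distrib_left by (rule sum.cong) (auto simp: algebra_simps)
  finally show ?thesis by (simp add: minus_one_power_iff)
qed

text \<open>
  Exchange of the two tensor factors, by reversal of the order of summation.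
\<close>

lemma racah_swap: "racah b a s j i = (-1) ^ s * racah a b s i j"
proof -
  show ?thesis
    unfolding racah_def sum_distrib_left
    by (rule sum.reindex_bij_witness[of _ "\<lambda>k. s - k" "\<lambda>k. s - k"])
       (auto simp: of_nat_diff minus_one_power_iff algebra_simps)
qed

text \<open>
  Exchange of the first factor with the target, up to sign: the symmetry of the \<open>3j\<close>-symbol that
  puts spin \<open>a + b\<close> in the place of spin \<open>a + s\<close>.  The substitution \<open>k \<mapsto> b + k - j\<close>
  permutes the six factorials.
\<close>

lemma racah_exchange:
  "(racah a s b (i + j - int s) (int b + int s - j))\<^sup>2 = (racah a b s i j)\<^sup>2"
proof -
  \<comment> \<open>The exponents \<open>k\<close> and \<open>b + k - j\<close> of the sign differ by \<open>b - j\<close>.\<close>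
  define \<sigma> where "\<sigma> = (if even (int b - j) then 1 else -1 :: real)"
  define h where "h k = (-1) ^ k * (rfact (int k) * rfact (int b - int k)
     * rfact (int a + int b - (i + j - int s) - int k) * rfact (int b + int s - j - int k)
     * rfact (i + j - int s + int k - int b) * rfact (int s + int k - (int b + int s - j)))" for k
  have "racah a b s i j = (\<Sum>k\<in>{k\<in>{..s}. 0 \<le> int b + int k - j \<and> int k \<le> j}.
     (-1) ^ k * (rfact (int k) * rfact (int s - int k)
     * rfact (int a + int s - i - int k) * rfact (j - int k)
     * rfact (i + int k - int s) * rfact (int b + int k - j)))"
    unfolding racah_def by (rule sum.mono_neutral_right) auto
  also have "\<dots> = (\<Sum>k\<in>{k\<in>{..b}. 0 \<le> int k + j - int b \<and> int k + j - int b \<le> int s}. \<sigma> * h k)"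
  proof (rule sum.reindex_bij_witness
      [of _ "\<lambda>k. nat (int k + j - int b)" "\<lambda>k. nat (int b + int k - j)"], goal_cases)
    case (5 k)
    then have "int (nat (int b + int k - j)) = int b + int k - j"
      by auto
    moreover from 5 have "even (nat (int b + int k - j)) \<longleftrightarrow> even (int b + int k - j)"
      by (auto simp: even_nat_iff)
    ultimately show ?case
      by (auto simp: h_def \<sigma>_def minus_one_power_iff algebra_simps)
  qed auto
  also have "\<dots> = (\<Sum>k\<le>b. \<sigma> * h k)"
    by (rule sum.mono_neutral_left) (auto simp: h_def)
  also have "\<dots> = \<sigma> * racah a s b (i + j - int s) (int b + int s - j)"
    unfolding racah_def sum_distrib_left h_def by (rule sum.cong) (auto simp: algebra_simps)
  finally show ?thesis by (simp add: power_mult_distrib \<sigma>_def)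
qed

text \<open>
  The raising operator, which is the lowering operator conjugated by the reflection of all weights.
\<close>

lemma racah_raise:
  "of_int (int a + int s - i + 1) * racah a b s (i - 1) j
     + of_int (int b + int s - j + 1) * racah a b s i (j - 1)
     = of_int (i + j - int s) * racah a b s i j"
  using racah_lower[of "int a + int s - i" a b s "int b + int s - j"]
    racah_flip[of a b s "i - 1" j] racah_flip[of a b s i "j - 1"] racah_flip[of a b s i j]
  by (auto simp: algebra_simps minus_one_power_iff split: if_splits)

section \<open>Squared Clebsch-Gordan coefficients and the degree of polynomials\<close>

text \<open>
  Up to the factor \<open>M!\<close>, the reciprocal of \<open>M choose i\<close>, which is the squared norm of the
  monomial of weight \<open>i\<close> in the representation of spin \<open>M\<close>.
\<close>

definition fact_weight :: "nat \<Rightarrow> nat \<Rightarrow> real" where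
  "fact_weight M i = fact i * fact (M - i)"

lemma fact_weight_flip: "i \<le> M \<Longrightarrow> fact_weight M (M - i) = fact_weight M i"
  by (simp add: fact_weight_def)

lemma minus_one_squared: "((- 1) ^ n)\<^sup>2 = (1 :: real)"
  by (simp add: minus_one_power_iff)

text \<open>
  The squared Clebsch-Gordan coefficient at the weights \<open>i\<close> and \<open>n + s - i\<close> of the factors and the
  weight \<open>n\<close> of the target.  It is defined through the \<open>racah\<close> sum with an integer
  argument in order to vanish by itself when \<open>i\<close> leaves its range.
\<close>

definition cg_dist :: "nat \<Rightarrow> nat \<Rightarrow> nat \<Rightarrow> nat \<Rightarrow> nat \<Rightarrow> real" where
  "cg_dist a b s i n = real (a + b + 1) * (fact a * fact b * fact s / fact (a + b + s + 1))
     * fact_weight (a + b) n * fact_weight (a + s) i * fact_weight (b + s) (n + s - i)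
     * (racah a b s (int i) (int n + int s - int i))\<^sup>2"

lemma cg_dist_eq_0: "i > a + s \<or> i > n + s \<or> n + s > i + (b + s) \<Longrightarrow> cg_dist a b s i n = 0"
  by (auto simp: cg_dist_def racah_eq_0)

lemma cg_dist_flip:
  assumes "i \<le> a + s" "n \<le> a + b"
  shows "cg_dist a b s (a + s - i) (a + b - n) = cg_dist a b s i n"
proof (cases "i \<le> n + s \<and> n + s \<le> i + (b + s)")
  case True
  then have "racah a b s (int (a + s - i)) (int (a + b - n) + int s - int (a + s - i))
      = (-1) ^ s * racah a b s (int i) (int n + int s - int i)"
    using assms racah_flip[of a b s "int i" "int n + int s - int i"]
    by (simp add: of_nat_diff algebra_simps)
  moreover have "a + b - n + s - (a + s - i) = b + s - (n + s - i)"
    using True assms by simp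
  moreover have "fact_weight (b + s) (b + s - (n + s - i)) = fact_weight (b + s) (n + s - i)"
  proof -
    have "b + s - (b + s - (n + s - i)) = n + s - i" using True by linarith
    then show ?thesis by (simp add: fact_weight_def)
  qed
  ultimately show ?thesis using assms True
    by (simp add: cg_dist_def power_mult_distrib minus_one_squared fact_weight_flip)
next
  case False
  then show ?thesis using assms by (subst (1 2) cg_dist_eq_0) auto
qed

lemma cg_dist_swap:
  assumes "i + j = n + s" "i \<le> a + s" "j \<le> b + s"
  shows "cg_dist b a s j n = cg_dist a b s i n"
proof -
  have *: "int n + int s - int j = int i" "int n + int s - int i = int j" "n + s - i = j" "n + s - j = i"
    using assms by linarith+
  show ?thesis
    by (simp only: cg_dist_def * racah_swap[of b a s "int j" "int i"])
       (simp add: power_mult_distrib minus_one_squared add_ac mult_ac)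
qed

text \<open>
  The two roles of the matrix \<open>cg_dist\<close>, as a map on functions of \<open>i\<close> and on functions of
  \<open>n\<close>, are interchanged by the symmetry of the \<open>3j\<close>-symbol.
\<close>

lemma cg_dist_exchange:
  assumes "i \<le> a + s" "n \<le> a + b"
  shows "cg_dist a b s i n = real (a + b + 1) / real (a + s + 1) * cg_dist a s b n i"
proof (cases "i \<le> n + s \<and> n + s \<le> i + (b + s)")
  case True
  have "(racah a s b (int n) (int i + int b - int n))\<^sup>2 = (racah a b s (int i) (int n + int s - int i))\<^sup>2"
    using racah_exchange[of a s b "int i" "int n + int s - int i"] by (simp add: algebra_simps)
  moreover have "fact_weight (s + b) (i + b - n) = fact_weight (b + s) (n + s - i)"
  proof -
    have "b + s - (n + s - i) = i + b - n" "s + b - (i + b - n) = n + s - i" using True by auto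
    then show ?thesis by (simp add: fact_weight_def)
  qed
  moreover have "fact a * fact s * fact b / fact (a + s + b + 1)
      = (fact a * fact b * fact s / fact (a + b + s + 1) :: real)"
    by (simp only: add_ac mult_ac)
  moreover have "real (a + s + 1) > 0" by simp
  ultimately show ?thesis
    by (simp only: cg_dist_def) simp
next
  case False
  then show ?thesis using assms by (subst (1 2) cg_dist_eq_0) auto
qed

lemma clebsch_gordan_squared:
  assumes "n1 \<le> a + s" "n2 \<le> b + s" "n \<le> a + b"
  shows "(clebsch_gordan (a + s) (b + s) (a + b) n1 n2 n)\<^sup>2
    = (if n1 + n2 = n + s then cg_dist a b s n1 n else 0)"
proof (cases "n1 + n2 = n + s")
  case False
  then show ?thesis by (simp add: clebsch_gordan_def Let_def)
next
  case True
  have e: "((a + s) + (b + s) - (a + b)) div 2 = s" "((a + b) + (a + s) - (b + s)) div 2 = a"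
    "((a + b) + (b + s) - (a + s)) div 2 = b" "((a + s) + (b + s) + (a + b)) div 2 + 1 = a + b + s + 1"
    by auto
  have sum: "(\<Sum>k | k \<le> s \<and> k \<le> (a + s) - n1 \<and> k \<le> n2 \<and> s \<le> n1 + k \<and> n2 \<le> b + k.
            (-1) ^ k / (fact k * fact (s - k) * fact ((a + s) - n1 - k) * fact (n2 - k)
                        * fact (n1 + k - s) * fact (b + k - n2)))
     = racah a b s (int n1) (int n2)"
    unfolding racah_def
  proof (rule sum.mono_neutral_cong_left)
    fix k assume k: "k \<in> {k. k \<le> s \<and> k \<le> (a + s) - n1 \<and> k \<le> n2 \<and> s \<le> n1 + k \<and> n2 \<le> b + k}"
    have "int s - int k = int (s - k)" "int a + int s - int n1 - int k = int ((a + s) - n1 - k)"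
      "int n2 - int k = int (n2 - k)" "int n1 + int k - int s = int (n1 + k - s)"
      "int b + int k - int n2 = int (b + k - n2)" using k assms by auto
    then show "(-1) ^ k / (fact k * fact (s - k) * fact ((a + s) - n1 - k) * fact (n2 - k)
                        * fact (n1 + k - s) * fact (b + k - n2))
      = (-1) ^ k * (rfact (int k) * rfact (int s - int k)
     * rfact (int a + int s - int n1 - int k) * rfact (int n2 - int k)
     * rfact (int n1 + int k - int s) * rfact (int b + int k - int n2))"
      by (simp only: rfact_of_nat) (simp add: divide_inverse)
  next
    show "\<forall>k\<in>{..s} - {k. k \<le> s \<and> k \<le> (a + s) - n1 \<and> k \<le> n2 \<and> s \<le> n1 + k \<and> n2 \<le> b + k}.
      (-1) ^ k * (rfact (int k) * rfact (int s - int k)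
     * rfact (int a + int s - int n1 - int k) * rfact (int n2 - int k)
     * rfact (int n1 + int k - int s) * rfact (int b + int k - int n2)) = 0"
    proof
      fix k assume "k \<in> {..s} - {k. k \<le> s \<and> k \<le> (a + s) - n1 \<and> k \<le> n2 \<and> s \<le> n1 + k \<and> n2 \<le> b + k}"
      then have "int a + int s - int n1 - int k < 0 \<or> int n2 - int k < 0
          \<or> int n1 + int k - int s < 0 \<or> int b + int k - int n2 < 0"
        using assms by auto
      then show "(-1) ^ k * (rfact (int k) * rfact (int s - int k)
         * rfact (int a + int s - int n1 - int k) * rfact (int n2 - int k)
         * rfact (int n1 + int k - int s) * rfact (int b + int k - int n2)) = 0"
        by auto
    qed
  qed auto
  have j: "n + s - n1 = n2" "int n + int s - int n1 = int n2"
    using True by auto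
  have nonneg1: "0 \<le> real (a + b + 1) * fact a * fact b * fact s / fact (a + b + s + 1)"
    by (rule divide_nonneg_nonneg[OF mult_nonneg_nonneg[OF mult_nonneg_nonneg[OF mult_nonneg_nonneg]]]) (rule fact_ge_zero of_nat_0_le_iff)+
  have nonneg2: "(0 :: real) \<le> fact n * fact (a + b - n) * fact n1 * fact (a + s - n1) * fact n2 * fact (b + s - n2)"
    by (intro mult_nonneg_nonneg fact_ge_zero)
  have "(clebsch_gordan (a + s) (b + s) (a + b) n1 n2 n)\<^sup>2
    = (real (a + b + 1) * fact a * fact b * fact s / fact (a + b + s + 1))
      * (fact n * fact (a + b - n) * fact n1 * fact (a + s - n1) * fact n2 * fact (b + s - n2))
      * (racah a b s (int n1) (int n2))\<^sup>2"
    unfolding clebsch_gordan_def Let_def e sum if_P[OF True] power_mult_distrib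
    by (simp only: real_sqrt_pow2 [OF nonneg1] real_sqrt_pow2 [OF nonneg2])
  then show ?thesis
    by (simp only: if_P[OF True] cg_dist_def fact_weight_def j times_divide_eq_right times_divide_eq_left mult_ac)
qed

definition fdiff :: "(nat \<Rightarrow> real) \<Rightarrow> nat \<Rightarrow> real" where
  "fdiff f n = f (Suc n) - f n"

text \<open>
  For \<open>E = \<partial>\<^sub>x\<close> acting on the first factor, this is the unnormalized matrix entry of
  \<open>\<beta>\<^sup>* g E\<^sup>m \<beta>\<close> between the weights \<open>n\<close> and \<open>n + m\<close>, where \<open>g\<close> acts by
  multiplication with a function of the first weight; the rising factorial comes from \<open>E\<^sup>m\<close>.
\<close>

definition cg_moment :: "nat \<Rightarrow> nat \<Rightarrow> nat \<Rightarrow> nat \<Rightarrow> (nat \<Rightarrow> real) \<Rightarrow> nat \<Rightarrow> real" where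
  "cg_moment a b s m g n = (\<Sum>i\<le>n + s. fact_weight (a + s) i * fact_weight (b + s) (n + s - i)
     * racah a b s (int i) (int (n + s - i)) * g i
     * (pochhammer (real (i + 1)) m * racah a b s (int (i + m)) (int (n + s - i))))"

text \<open>
  With the norms of the monomials included, the raising recurrence says how the adjoint of
  \<open>\<partial>\<^sub>x + \<partial>\<^sub>z\<close> acts.  At the lower ends of the ranges the truncated subtraction is harmless
  because its coefficient is zero.
\<close>

lemma weighted_racah_raise:
  assumes "i \<le> a + s" "j \<le> b + s"
  defines "w \<equiv> \<lambda>i j. fact_weight (a + s) i * fact_weight (b + s) j * racah a b s (int i) (int j)"
  shows "real i * w (i - 1) j + real j * w i (j - 1) = (real i + real j - real s) * w i j"
proof -
  have fw: "real k * fact_weight M (k - 1) * r (int (k - 1))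
      = (real M - real k + 1) * fact_weight M k * r (int k - 1)"
    if "k \<le> M" "r (- 1) = 0" for k M and r :: "int \<Rightarrow> real"
  proof (cases k)
    case 0
    then show ?thesis using that by simp
  next
    case (Suc l)
    then have "M - l = Suc (M - k)" using that by simp
    then have "(fact (M - l) :: real) = (real M - real k + 1) * fact (M - k)"
      using that by (simp add: of_nat_diff)
    then show ?thesis using Suc by (simp add: fact_weight_def)
  qed
  have "real i * w (i - 1) j = (real (a + s) - real i + 1) * fact_weight (a + s) i * fact_weight (b + s) j
      * racah a b s (int i - 1) (int j)"
    using fw[OF assms(1), of "\<lambda>k. racah a b s k (int j)"] unfolding w_def
    by (simp add: racah_eq_0 mult_ac)
  moreover have "real j * w i (j - 1) = (real (b + s) - real j + 1) * fact_weight (a + s) i * fact_weight (b + s) j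
      * racah a b s (int i) (int j - 1)"
    using fw[OF assms(2), of "racah a b s (int i)"] unfolding w_def
    by (simp add: racah_eq_0 mult_ac)
  ultimately have "real i * w (i - 1) j + real j * w i (j - 1)
     = fact_weight (a + s) i * fact_weight (b + s) j *
       (of_int (int a + int s - int i + 1) * racah a b s (int i - 1) (int j)
     + of_int (int b + int s - int j + 1) * racah a b s (int i) (int j - 1))"
    by (simp add: algebra_simps)
  then show ?thesis unfolding racah_raise w_def by (simp add: algebra_simps)
qed

text \<open>
  The commutator with \<open>E\<close>: as \<open>E\<^sup>m\<close> commutes with \<open>\<partial>\<^sub>x + \<partial>\<^sub>z\<close>, moving the total
  lowering operator from one copy of \<open>\<beta>\<close> to the other leaves only the commutator of
  \<open>\<partial>\<^sub>x\<close> with multiplication by \<open>g\<close>, that is, multiplication by the difference of \<open>g\<close>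
  followed by one more \<open>\<partial>\<^sub>x\<close>.
\<close>

lemma cg_moment_Suc:
  "cg_moment a b s (Suc m) (fdiff g) n
   = real (n + 1) * cg_moment a b s m g (Suc n) - (real (a + b) - real n - real m) * cg_moment a b s m g n"
proof -
  define w where "w i j = fact_weight (a + s) i * fact_weight (b + s) j * racah a b s (int i) (int j)" for i j
  define R where "R i j = racah a b s (int i) (int j)" for i j
  define p where "p i m = pochhammer (real (i + 1)) m" for i m
  have Z: "cg_moment a b s m g n = (\<Sum>i\<le>n + s. w i (n + s - i) * g i * (p i m * R (i + m) (n + s - i)))"
    for m g n by (simp add: cg_moment_def w_def R_def p_def)
  have lower: "(real (a + b) - real n - real m) * (p i m * R (i + m) (n + s - i))
      = p i (Suc m) * R (i + Suc m) (n + s - i)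
        + real (n + s - i + 1) * (p i m * R (i + m) (n + s - i + 1))" if "i \<le> n + s" for i
  proof -
    define j where "j = n + s - i"
    have "real (i + m + 1) * R (i + Suc m) j + real (j + 1) * R (i + m) (j + 1)
        = (real (a + b) - real n - real m) * R (i + m) j"
    proof -
      have e: "int (i + m) + 1 = int (i + Suc m)" "int j + 1 = int (j + 1)"
        "int (i + Suc m) = int (i + m + 1)"
        by simp_all
      have "int a + int b + int s - int (i + m) - int j = int a + int b - int n - int m"
        using that by (simp add: j_def of_nat_diff)
      then have K: "real_of_int (int a + int b + int s - int (i + m) - int j) = real (a + b) - real n - real m"
        by simp
      show ?thesis
        using racah_lower[of "int (i + m)" a b s "int j"] unfolding K unfolding e R_def of_int_of_nat_eq .
    qed
    note E = this
    have P: "p i (Suc m) = p i m * real (i + m + 1)"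
      by (simp add: p_def pochhammer_Suc)
    have "(real (a + b) - real n - real m) * (p i m * R (i + m) j)
        = p i m * ((real (a + b) - real n - real m) * R (i + m) j)" by (simp only: mult_ac)
    also have "\<dots> = p i (Suc m) * R (i + Suc m) j + real (j + 1) * (p i m * R (i + m) (j + 1))"
      unfolding E[symmetric] P by (simp only: distrib_left mult_ac)
    finally show ?thesis unfolding j_def .
  qed
  have "(real (a + b) - real n - real m) * cg_moment a b s m g n
     = (\<Sum>i\<le>n + s. w i (n + s - i) * g i * ((real (a + b) - real n - real m) * (p i m * R (i + m) (n + s - i))))"
    unfolding Z sum_distrib_left by (simp add: mult_ac)
  also have "\<dots> = cg_moment a b s (Suc m) g n
     + (\<Sum>i\<le>n + s. real (n + s - i + 1) * w i (n + s - i) * g i * (p i m * R (i + m) (n + s - i + 1)))"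
    unfolding Z sum.distrib[symmetric]
    by (rule sum.cong) (simp_all only: lower atMost_iff, simp only: ring_distribs mult_ac)
  also have "(\<Sum>i\<le>n + s. real (n + s - i + 1) * w i (n + s - i) * g i * (p i m * R (i + m) (n + s - i + 1)))
     = (\<Sum>i\<le>Suc (n + s). (real (Suc (n + s) - i) * w i (Suc (n + s) - i - 1)) * g i * (p i m * R (i + m) (Suc (n + s) - i)))"
  proof -
    have "real (n + s - i + 1) * w i (n + s - i) * g i * (p i m * R (i + m) (n + s - i + 1))
      = (real (Suc (n + s) - i) * w i (Suc (n + s) - i - 1)) * g i * (p i m * R (i + m) (Suc (n + s) - i))"
      if "i \<in> {..n + s}" for i
    proof -
      have "Suc (n + s) - i = n + s - i + 1" using that by auto
      then show ?thesis by simp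
    qed
    then show ?thesis
      by (simp only: sum.atMost_Suc diff_self_eq_0 of_nat_0 mult_zero_left add_0_right cong: sum.cong)
  qed
  also have "\<dots> = (\<Sum>i\<le>Suc (n + s). (real (n + 1) * w i (Suc (n + s) - i) - real i * w (i - 1) (Suc (n + s) - i))
        * g i * (p i m * R (i + m) (Suc (n + s) - i)))"
  proof (rule sum.cong[OF refl])
    fix i assume i: "i \<in> {..Suc (n + s)}"
    show "(real (Suc (n + s) - i) * w i (Suc (n + s) - i - 1)) * g i * (p i m * R (i + m) (Suc (n + s) - i))
      = (real (n + 1) * w i (Suc (n + s) - i) - real i * w (i - 1) (Suc (n + s) - i))
        * g i * (p i m * R (i + m) (Suc (n + s) - i))"
    proof (cases "i \<le> a + s \<and> Suc (n + s) - i \<le> b + s")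
      case True
      have "real i + real (Suc (n + s) - i) - real s = real (n + 1)" using i by (simp add: of_nat_diff)
      moreover have "real i * w (i - 1) (Suc (n + s) - i) + real (Suc (n + s) - i) * w i (Suc (n + s) - i - 1)
          = (real i + real (Suc (n + s) - i) - real s) * w i (Suc (n + s) - i)"
        using weighted_racah_raise[of i a s "Suc (n + s) - i" b] True unfolding w_def by blast
      ultimately have "real (Suc (n + s) - i) * w i (Suc (n + s) - i - 1)
          = real (n + 1) * w i (Suc (n + s) - i) - real i * w (i - 1) (Suc (n + s) - i)"
        by (simp only: algebra_simps)
      then show ?thesis by (simp only:)
    next
      case False
      \<comment> \<open>Beyond the upper ends the weighted recurrence fails, but there the other factor vanishes.\<close>
      then have "R (i + m) (Suc (n + s) - i) = 0" unfolding R_def by (intro racah_eq_0) auto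
      then show ?thesis by simp
    qed
  qed
  also have "\<dots> = real (n + 1) * cg_moment a b s m g (Suc n)
     - (\<Sum>i\<le>Suc (n + s). real i * w (i - 1) (Suc (n + s) - i) * g i * (p i m * R (i + m) (Suc (n + s) - i)))"
    unfolding Z add_Suc sum_distrib_left sum_subtractf[symmetric]
    by (rule sum.cong) (simp_all only: left_diff_distrib right_diff_distrib mult_ac)
  also have "(\<Sum>i\<le>Suc (n + s). real i * w (i - 1) (Suc (n + s) - i) * g i * (p i m * R (i + m) (Suc (n + s) - i)))
     = (\<Sum>i\<le>n + s. real (i + 1) * w i (n + s - i) * g (Suc i) * (p (Suc i) m * R (i + Suc m) (n + s - i)))"
    by (subst sum.atMost_Suc_shift) simp
  also have "\<dots> = cg_moment a b s (Suc m) (\<lambda>i. g (Suc i)) n"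
    unfolding Z
  proof (rule sum.cong[OF refl])
    fix i
    have "p i (Suc m) = real (i + 1) * p (Suc i) m"
      unfolding p_def by (simp add: pochhammer_rec add_ac)
    then show "real (i + 1) * w i (n + s - i) * g (Suc i) * (p (Suc i) m * R (i + Suc m) (n + s - i))
       = w i (n + s - i) * g (Suc i) * (p i (Suc m) * R (i + Suc m) (n + s - i))"
      by simp
  qed
  finally have "(real (a + b) - real n - real m) * cg_moment a b s m g n
     = cg_moment a b s (Suc m) g n + (real (n + 1) * cg_moment a b s m g (Suc n)
       - cg_moment a b s (Suc m) (\<lambda>i. g (Suc i)) n)" .
  moreover have "cg_moment a b s (Suc m) (fdiff g) n
     = cg_moment a b s (Suc m) (\<lambda>i. g (Suc i)) n - cg_moment a b s (Suc m) g n"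
    unfolding Z fdiff_def sum_subtractf[symmetric] by (rule sum.cong) (simp_all only: ring_distribs mult_ac)
  ultimately show ?thesis by linarith
qed

lemma fdiff_pow_Suc: "(fdiff ^^ Suc m) f n = (fdiff ^^ m) f (Suc n) - (fdiff ^^ m) f n"
  by (simp add: fdiff_def)

lemma fdiff_pow_cmult: "(fdiff ^^ m) (\<lambda>n. c * f n) n = c * (fdiff ^^ m) f n"
  by (induction m arbitrary: n) (simp_all add: fdiff_def algebra_simps)

lemma fdiff_pow_sum: "(fdiff ^^ m) (\<lambda>n. \<Sum>x\<in>A. f x n) n = (\<Sum>x\<in>A. (fdiff ^^ m) (f x) n)"
  by (induction m arbitrary: n) (simp_all add: fdiff_def sum_subtractf)

lemma fdiff_pow_cong:
  "(\<And>k. n \<le> k \<Longrightarrow> k \<le> n + m \<Longrightarrow> f k = g k) \<Longrightarrow> (fdiff ^^ m) f n = (fdiff ^^ m) g n"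
  by (induction m arbitrary: n) (simp_all add: fdiff_def)

text \<open>
  Iterating the commutator turns an \<open>m\<close>-th difference of \<open>g\<close> into the \<open>m\<close>-th difference of the
  diagonal of \<open>\<beta>\<^sup>* g \<beta>\<close>; the factorials are those collected from the ladder coefficients.
\<close>

lemma cg_moment_fdiff:
  assumes "n + m \<le> a + b"
  shows "fact n * fact (a + b - n - m) * cg_moment a b s m ((fdiff ^^ m) g) n
    = (fdiff ^^ m) (\<lambda>n. fact_weight (a + b) n * cg_moment a b s 0 g n) n"
  using assms
proof (induction m arbitrary: n)
  case 0
  then show ?case by (simp add: fact_weight_def)
next
  case (Suc m)
  let ?h = "(fdiff ^^ m) g"
  have f: "(fact (a + b - n - m) :: real) = (real (a + b) - real n - real m) * fact (a + b - n - Suc m)"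
  proof -
    have "a + b - n - m = Suc (a + b - n - Suc m)" using Suc.prems by simp
    then show ?thesis using Suc.prems by (simp add: of_nat_diff)
  qed
  have 1: "fact (Suc n) * fact (a + b - n - Suc m) * cg_moment a b s m ?h (Suc n)
      = (fdiff ^^ m) (\<lambda>n. fact_weight (a + b) n * cg_moment a b s 0 g n) (Suc n)"
    using Suc.IH[of "Suc n"] Suc.prems by simp
  have 2: "fact n * fact (a + b - n - m) * cg_moment a b s m ?h n
      = (fdiff ^^ m) (\<lambda>n. fact_weight (a + b) n * cg_moment a b s 0 g n) n"
    using Suc.IH[of n] Suc.prems by simp
  show ?case
  proof -
    have "(fdiff ^^ Suc m) g = fdiff ?h" by simp
    then show ?thesis
      unfolding fdiff_pow_Suc 1[symmetric] 2[symmetric] f cg_moment_Suc fact_Suc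
      by (simp only: cg_moment_Suc) (simp only: right_diff_distrib left_diff_distrib mult_ac Suc_eq_plus1 of_nat_mult)
  qed
qed

lemma cg_dist_nonzero: "cg_dist a b s i n \<noteq> 0 \<Longrightarrow> i \<le> a + s \<and> i \<le> n + s \<and> n + s \<le> i + (b + s)"
  using cg_dist_eq_0[of a s i n b] by fastforce

lemma cg_dist_average:
  "(\<Sum>i\<le>a + s. cg_dist a b s i n * g i)
    = real (a + b + 1) * (fact a * fact b * fact s / fact (a + b + s + 1))
      * (fact_weight (a + b) n * cg_moment a b s 0 g n)" (is "_ = ?c * _")
proof -
  have "(\<Sum>i\<le>a + s. cg_dist a b s i n * g i) = (\<Sum>i | i \<le> a + s \<and> i \<le> n + s. cg_dist a b s i n * g i)"
    by (rule sum.mono_neutral_right) (auto dest: cg_dist_nonzero)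
  also have "\<dots> = (\<Sum>i\<le>n + s. cg_dist a b s i n * g i)"
    by (rule sum.mono_neutral_left) (auto dest: cg_dist_nonzero)
  also have "\<dots> = ?c * (fact_weight (a + b) n * cg_moment a b s 0 g n)"
    unfolding cg_moment_def sum_distrib_left
    by (rule sum.cong) (auto simp: cg_dist_def of_nat_diff power2_eq_square simp del: fact_Suc)
  finally show ?thesis .
qed

text \<open>
  Polynomials of degree less than \<open>m\<close> in \<open>i\<close> are averaged to such polynomials in \<open>n\<close>.  Degree is
  expressed by vanishing \<open>m\<close>-th differences at those points where they involve only
  weights in range; for \<open>m\<close> exceeding the size of a range the condition is empty.
\<close>

lemma average_degree:
  assumes "\<And>i. i + m \<le> a + s \<Longrightarrow> (fdiff ^^ m) g i = 0" "n + m \<le> a + b"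
  shows "(fdiff ^^ m) (\<lambda>n. \<Sum>i\<le>a + s. cg_dist a b s i n * g i) n = 0"
proof -
  have "cg_moment a b s m ((fdiff ^^ m) g) n = 0"
    unfolding cg_moment_def
  proof (rule sum.neutral, rule ballI)
    fix i
    show "fact_weight (a + s) i * fact_weight (b + s) (n + s - i)
     * racah a b s (int i) (int (n + s - i)) * (fdiff ^^ m) g i
     * (pochhammer (real (i + 1)) m * racah a b s (int (i + m)) (int (n + s - i))) = 0"
      using assms(1)[of i] racah_eq_0[of "int (i + m)" a s "int (n + s - i)" b]
      by (cases "i + m \<le> a + s") auto
  qed
  then show ?thesis
    unfolding cg_dist_average fdiff_pow_cmult cg_moment_fdiff[OF assms(2), symmetric] by simp
qed

lemma dual_average_degree:
  assumes "\<And>n. n + m \<le> a + b \<Longrightarrow> (fdiff ^^ m) h n = 0" "i + m \<le> a + s"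
  shows "(fdiff ^^ m) (\<lambda>i. \<Sum>n\<le>a + b. cg_dist a b s i n * h n) i = 0"
proof -
  have "(fdiff ^^ m) (\<lambda>i. \<Sum>n\<le>a + b. cg_dist a b s i n * h n) i
    = (fdiff ^^ m) (\<lambda>i. real (a + b + 1) / real (a + s + 1) * (\<Sum>n\<le>a + b. cg_dist a s b n i * h n)) i"
  proof (rule fdiff_pow_cong)
    fix k assume "i \<le> k" "k \<le> i + m"
    then have k: "k \<le> a + s" using assms(2) by simp
    show "(\<Sum>n\<le>a + b. cg_dist a b s k n * h n)
        = real (a + b + 1) / real (a + s + 1) * (\<Sum>n\<le>a + b. cg_dist a s b n k * h n)"
      unfolding sum_distrib_left
    proof (rule sum.cong[OF refl])
      fix n assume "n \<in> {..a + b}"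
      then show "cg_dist a b s k n * h n
          = real (a + b + 1) / real (a + s + 1) * (cg_dist a s b n k * h n)"
        using cg_dist_exchange[OF k, of n b] by (simp only: atMost_iff mult.assoc)
    qed
  qed
  then show ?thesis
    by (simp only: fdiff_pow_cmult average_degree[OF assms] mult_zero_right)
qed

lemma newton_expansion: "f q = (\<Sum>k\<le>q. real (q choose k) * (fdiff ^^ k) f 0)"
proof -
  have "f (x + q) = (\<Sum>k\<le>q. real (q choose k) * (fdiff ^^ k) f x)" for x
  proof (induction q arbitrary: x)
    case 0
    then show ?case by simp
  next
    case (Suc q)
    have "f (x + Suc q) = (\<Sum>k\<le>q. real (q choose k) * ((fdiff ^^ k) f x + (fdiff ^^ Suc k) f x))"
      using Suc.IH[of "Suc x"] by (simp add: fdiff_pow_Suc del: funpow.simps)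
    also have "\<dots> = (\<Sum>k\<le>Suc q. real (q choose k) * (fdiff ^^ k) f x)
        + (\<Sum>k\<le>q. real (q choose k) * (fdiff ^^ Suc k) f x)"
      by (simp add: algebra_simps sum.distrib)
    also have "\<dots> = f x + (\<Sum>k\<le>q. real (Suc q choose Suc k) * (fdiff ^^ Suc k) f x)"
      by (subst sum.atMost_Suc_shift) (simp add: algebra_simps sum.distrib)
    also have "\<dots> = (\<Sum>k\<le>Suc q. real (Suc q choose k) * (fdiff ^^ k) f x)"
      by (subst sum.atMost_Suc_shift) simp
    finally show ?case .
  qed
  from this[of 0] show ?thesis by simp
qed

text \<open>
  The trace computed in the Newton basis \<open>q choose k\<close>, whose coordinate functionals are the iterated
  differences at \<open>0\<close>.  It reduces a statement about a trace to one about degrees.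
\<close>

lemma trace_newton:
  "(\<Sum>q\<le>L. A q q) = (\<Sum>k\<le>L. (fdiff ^^ k) (\<lambda>x. \<Sum>q\<le>L. A x q * real (q choose k)) 0)"
proof -
  have "A q q = (\<Sum>k\<le>L. (fdiff ^^ k) (\<lambda>x. A x q * real (q choose k)) 0)" if "q \<le> L" for q
  proof -
    have "A q q = (\<Sum>k\<le>q. real (q choose k) * (fdiff ^^ k) (\<lambda>x. A x q) 0)"
      by (rule newton_expansion)
    also have "\<dots> = (\<Sum>k\<le>L. real (q choose k) * (fdiff ^^ k) (\<lambda>x. A x q) 0)"
      using that by (intro sum.mono_neutral_left) auto
    finally show ?thesis by (simp only: fdiff_pow_cmult mult.commute[of _ "real (q choose _)"])
  qed
  then have "(\<Sum>q\<le>L. A q q) = (\<Sum>q\<le>L. \<Sum>k\<le>L. (fdiff ^^ k) (\<lambda>x. A x q * real (q choose k)) 0)"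
    by (intro sum.cong) auto
  also have "\<dots> = (\<Sum>k\<le>L. (fdiff ^^ k) (\<lambda>x. \<Sum>q\<le>L. A x q * real (q choose k)) 0)"
    by (subst sum.swap) (simp add: fdiff_pow_sum)
  finally show ?thesis .
qed

lemma fdiff_pow_binomial: "(fdiff ^^ m) (\<lambda>q. real (q choose k)) n = (if m \<le> k then real (n choose (k - m)) else 0)"
proof (induction m arbitrary: n)
  case (Suc m)
  then show ?case
  proof (cases "Suc m \<le> k")
    case True
    then have "k - m = Suc (k - Suc m)" by simp
    then show ?thesis using True by (simp only: fdiff_pow_Suc Suc.IH) simp
  next
    case False
    then show ?thesis by (simp only: fdiff_pow_Suc Suc.IH) auto
  qed
qed simp

lemma fdiff_pow_shift: "(fdiff ^^ m) (\<lambda>i. f (i + c)) i = (fdiff ^^ m) f (i + c)"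
  by (induction m arbitrary: i) (simp_all add: fdiff_def)

text \<open>
  The operator with this trace lowers the degree: both averages preserve it and the difference
  in between lowers it by one.  So all its diagonal entries in the Newton basis are zero.
\<close>

lemma trace_shift:
  assumes "p \<le> L" "p' \<le> L" "p + s + c + 1 \<le> p' + s'"
  shows "(\<Sum>q\<le>L. \<Sum>i\<le>p + s. cg_dist p (L - p) s i q
     * (cg_dist p' (L - p') s' (i + c + 1) q - cg_dist p' (L - p') s' (i + c) q)) = 0"
proof -
  define D where "D = cg_dist p (L - p) s"
  define D' where "D' = cg_dist p' (L - p') s'"
  define A where "A x q = (\<Sum>i\<le>p + s. D i x * (D' (i + c + 1) q - D' (i + c) q))" for x q
  have "(fdiff ^^ k) (\<lambda>x. \<Sum>q\<le>L. A x q * real (q choose k)) 0 = 0" if k: "k \<le> L" for k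
  proof -
    define f where "f i = (\<Sum>q\<le>L. D' i q * real (q choose k))" for i
    have f: "(fdiff ^^ Suc k) f i = 0" if "i + Suc k \<le> p' + s'" for i
      using dual_average_degree[of "Suc k" p' "L - p'" "\<lambda>q. real (q choose k)" i s'] that assms
      unfolding f_def D'_def by (simp only: fdiff_pow_binomial) simp
    define h where "h i = f (i + c + 1) - f (i + c)" for i
    have h: "(fdiff ^^ k) h i = 0" if "i + k \<le> p + s" for i
    proof -
      have "h = (\<lambda>i. fdiff f (i + c))" by (simp add: h_def[abs_def] fdiff_def)
      then have "(fdiff ^^ k) h i = (fdiff ^^ Suc k) f (i + c)"
        by (simp only: fdiff_pow_shift funpow_Suc_right o_apply)
      also have "\<dots> = 0" using that assms by (intro f) simp
      finally show ?thesis .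
    qed
    have "(\<Sum>q\<le>L. A x q * real (q choose k)) = (\<Sum>i\<le>p + s. D i x * h i)" for x
      unfolding A_def h_def f_def sum_distrib_right
      by (subst sum.swap) (simp add: sum_distrib_left sum_subtractf[symmetric] algebra_simps)
    then show ?thesis
      using average_degree[of k p s h 0 "L - p"] h k assms unfolding D_def by simp
  qed
  then have "(\<Sum>q\<le>L. A q q) = 0" unfolding trace_newton[of A L] by simp
  then show ?thesis unfolding A_def D_def D'_def .
qed

section \<open>Orthogonality of the diagonal entries\<close>

lemma has_integral_cis:
  "((\<lambda>t. cis (real_of_int k * t)) has_integral
     (if k = 0 then of_real pi else (cis (real_of_int k * pi) - 1) / (\<i> * of_int k))) {0..pi}"
proof (cases "k = 0")
  case True
  then show ?thesis using has_integral_const_real[of "1 :: complex" 0 pi]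
    by (simp add: scaleR_conv_of_real)
next
  case False
  have "((\<lambda>t. exp (\<i> * of_int k * of_real t) / (\<i> * of_int k)) has_vector_derivative
      exp (\<i> * of_int k * of_real t)) (at t within {0..pi})" for t
    using False by (intro has_vector_derivative_real_field) (auto intro!: derivative_eq_intros)
  then have "((\<lambda>t. exp (\<i> * of_int k * of_real t)) has_integral
      exp (\<i> * of_int k * of_real pi) / (\<i> * of_int k) - exp (\<i> * of_int k * of_real 0) / (\<i> * of_int k)) {0..pi}"
    by (intro fundamental_theorem_of_calculus) auto
  then show ?thesis using False
    by (simp add: cis_conv_exp diff_divide_distrib mult.assoc)
qed

definition sin2_coeff :: "int \<Rightarrow> complex" where
  "sin2_coeff k = integral {0..pi} (\<lambda>t. cis (real_of_int k * t) * of_real ((sin t)\<^sup>2))"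

lemma has_integral_cis_sin2:
  defines "J \<equiv> \<lambda>k :: int. (if k = 0 then of_real pi else (cis (real_of_int k * pi) - 1) / (\<i> * of_int k)) :: complex"
  shows "((\<lambda>t. cis (real_of_int k * t) * of_real ((sin t)\<^sup>2)) has_integral
     (2 * J k - J (k + 2) - J (k - 2)) / 4) {0..pi}"
proof -
  have "cis (real_of_int k * t) * of_real ((sin t)\<^sup>2)
      = (2 * cis (real_of_int k * t) - cis (real_of_int (k + 2) * t) - cis (real_of_int (k - 2) * t)) / 4" for t
  proof -
    have "of_real ((sin t)\<^sup>2) = (2 - cis (2 * t) - cis (- (2 * t))) / 4"
      by (simp add: complex_eq_iff cos_double_sin)
    moreover have "real_of_int (k + 2) * t = real_of_int k * t + 2 * t"
      "real_of_int (k - 2) * t = real_of_int k * t + - (2 * t)"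
      by (simp_all add: algebra_simps)
    ultimately show ?thesis by (simp only: cis_mult[symmetric]) (simp add: field_simps)
  qed
  moreover have "((\<lambda>t. (2 * cis (real_of_int k * t) - cis (real_of_int (k + 2) * t) - cis (real_of_int (k - 2) * t)) / 4)
      has_integral (2 * J k - J (k + 2) - J (k - 2)) / 4) {0..pi}"
    unfolding J_def
    by (intro has_integral_divide has_integral_diff has_integral_mult_right has_integral_cis)
  ultimately show ?thesis by (simp only:)
qed

lemma sin2_coeff_has_integral:
  "((\<lambda>t. cis (real_of_int k * t) * of_real ((sin t)\<^sup>2)) has_integral sin2_coeff k) {0..pi}"
  unfolding sin2_coeff_def using has_integral_cis_sin2 by (blast intro: integrable_integral)

lemma cis_int_pi: "cis (real_of_int k * pi) = (if even k then 1 else - 1)"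
  by (simp add: complex_eq_iff cos_npi_int sin_npi_int mult.commute)

text \<open>
  Only the part \<open>\<i> sin (k t)\<close> of \<open>cis (k t)\<close> survives on the half period when \<open>k\<close> is odd.
\<close>

lemma sin2_coeff_odd:
  assumes "odd k"
  shows "sin2_coeff (- k) = - sin2_coeff k"
proof -
  define J where "J m = (if m = 0 then of_real pi else (cis (real_of_int m * pi) - 1) / (\<i> * of_int m) :: complex)"
    for m :: int
  have J: "J (- m) = - J m" if "odd m" for m
    using that cis_int_pi[of m] cis_int_pi[of "- m"] by (auto simp: J_def)
  have c: "sin2_coeff m = (2 * J m - J (m + 2) - J (m - 2)) / 4" for m
    unfolding sin2_coeff_def J_def by (rule integral_unique[OF has_integral_cis_sin2])
  have "odd (k - 2)" "odd (k + 2)" using assms by simp_all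
  then have "J (- k + 2) = - J (k - 2)" "J (- k - 2) = - J (k + 2)" "J (- k) = - J k"
    using assms J[of "k - 2"] J[of "k + 2"] J[of k] by simp_all
  then show ?thesis unfolding c by (simp only:) (simp add: field_simps)
qed

lemma sin2_coeff_even:
  "sin2_coeff (2 * l) = of_real (pi / 4) * ((if l = 0 then 2 else 0) - (if l = 1 then 1 else 0) - (if l = - 1 then 1 else 0))"
proof -
  have "2 * l + 2 = 0 \<longleftrightarrow> l = - 1" "2 * l - 2 = 0 \<longleftrightarrow> l = 1" by auto
  then show ?thesis
    unfolding sin2_coeff_def integral_unique[OF has_integral_cis_sin2] cis_int_pi by simp
qed

text \<open>
  The two hypotheses match the parity of \<open>N' - N\<close>: the reflection disposes of the odd case, where the
  coefficients are odd; in the even case only three diagonals of \<open>M\<close> are seen,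
  with weights \<open>2\<close>, \<open>-1\<close>, \<open>-1\<close>, and \<open>shift\<close> says that their sums agree.
\<close>

lemma sin2_pairing_zero:
  fixes M :: "nat \<Rightarrow> nat \<Rightarrow> complex"
  assumes lt: "N < N'"
    and flip: "\<And>i j. i \<le> N \<Longrightarrow> j \<le> N' \<Longrightarrow> M (N - i) (N' - j) = M i j"
    and shift: "\<And>c. N + c + 1 \<le> N' \<Longrightarrow> (\<Sum>i\<le>N. M i (i + c + 1)) = (\<Sum>i\<le>N. M i (i + c))"
  shows "(\<Sum>i\<le>N. \<Sum>j\<le>N'. M i j * sin2_coeff (int N - int N' - 2 * int i + 2 * int j)) = 0"
    (is "?S = 0")
proof (cases "even (int N - int N')")
  case False
  define k where "k i j = int N - int N' - 2 * int i + 2 * int j" for i j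
  have k: "sin2_coeff (k (N - i) (N' - j)) = - sin2_coeff (k i j)" if "i \<le> N" "j \<le> N'" for i j
  proof -
    have "k (N - i) (N' - j) = - k i j" using that by (simp add: k_def of_nat_diff)
    moreover have "odd (k i j)" using False by (simp add: k_def)
    ultimately show ?thesis by (simp add: sin2_coeff_odd)
  qed
  have "(\<Sum>i\<le>N. \<Sum>j\<le>N'. M i j * sin2_coeff (k i j))
     = (\<Sum>i\<le>N. \<Sum>j\<le>N'. M (N - i) (N' - j) * sin2_coeff (k (N - i) (N' - j)))"
    by (rule sum.reindex_bij_witness[of _ "\<lambda>i. N - i" "\<lambda>i. N - i"],
        simp_all, rule sum.reindex_bij_witness[of _ "\<lambda>i. N' - i" "\<lambda>i. N' - i"]) auto
  also have "\<dots> = (\<Sum>i\<le>N. \<Sum>j\<le>N'. - (M i j * sin2_coeff (k i j)))"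
    by (intro sum.cong refl) (simp add: flip k)
  finally show ?thesis unfolding k_def by (simp add: sum_negf)
next
  case True
  then obtain e where "int N - int N' = 2 * e" by blast
  then have "int N' = int (N + 2 * nat (- e))" using lt by simp
  then have N': "N' = N + 2 * nat (- e)" by linarith
  define c where "c = nat (- e) - 1"
  have N': "N' = N + 2 * (c + 1)" using N' lt unfolding c_def by (cases "nat (- e)") auto
  have "(\<Sum>j\<le>N'. M i j * sin2_coeff (int N - int N' - 2 * int i + 2 * int j))
     = of_real (pi / 4) * (2 * M i (i + (c + 1)) - M i (i + (c + 1) + 1) - M i (i + c))" if "i \<le> N" for i
  proof -
    have "sin2_coeff (int N - int N' - 2 * int i + 2 * int j) = of_real (pi / 4) *
       ((if j = i + c + 1 then 2 else 0) - (if j = i + c + 2 then 1 else 0) - (if j = i + c then 1 else 0))" for j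
    proof -
      have "int N - int N' - 2 * int i + 2 * int j = 2 * (int j - int i - int (c + 1))" by (simp add: N')
      moreover have "int j - int i - int (c + 1) = 0 \<longleftrightarrow> j = i + c + 1"
        "int j - int i - int (c + 1) = 1 \<longleftrightarrow> j = i + c + 2"
        "int j - int i - int (c + 1) = - 1 \<longleftrightarrow> j = i + c" by auto
      ultimately show ?thesis by (simp only: sin2_coeff_even)
    qed
    then have "(\<Sum>j\<le>N'. M i j * sin2_coeff (int N - int N' - 2 * int i + 2 * int j))
      = of_real (pi / 4) * (\<Sum>j\<le>N'. (if j = i + c + 1 then 2 * M i j else 0)
         - (if j = i + c + 2 then M i j else 0) - (if j = i + c then M i j else 0))"
      by (simp only: sum_distrib_left) (intro sum.cong refl, auto)
    also have "\<dots> = of_real (pi / 4) * (2 * M i (i + (c + 1)) - M i (i + (c + 1) + 1) - M i (i + c))"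
    proof -
      have "i + c + 1 \<le> N'" "i + c + 2 \<le> N'" "i + c \<le> N'" using that N' by auto
      then show ?thesis by (simp add: sum_subtractf)
    qed
    finally show ?thesis .
  qed
  then have "?S = (\<Sum>i\<le>N. of_real (pi / 4) * (2 * M i (i + (c + 1)) - M i (i + (c + 1) + 1) - M i (i + c)))"
    by (intro sum.cong refl) (simp only: atMost_iff)
  also have "\<dots> = of_real (pi / 4) * (2 * (\<Sum>i\<le>N. M i (i + (c + 1)))
      - (\<Sum>i\<le>N. M i (i + (c + 1) + 1)) - (\<Sum>i\<le>N. M i (i + c)))"
    by (simp only: sum_distrib_left right_diff_distrib sum_subtractf)
  also have "(\<Sum>i\<le>N. M i (i + (c + 1) + 1)) = (\<Sum>i\<le>N. M i (i + (c + 1)))"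
    by (rule shift) (simp add: N')
  also have "(\<Sum>i\<le>N. M i (i + c)) = (\<Sum>i\<le>N. M i (i + c + 1))"
    by (rule shift[symmetric]) (simp add: N')
  finally show ?thesis by simp
qed

text \<open>
  The diagonal entry of \<open>\<Phi>(a\<^sub>t)\<close> at \<open>q\<close>, with the weight \<open>q + s - i\<close> of the second factor
  eliminated from the exponent.
\<close>

definition spherical :: "nat \<Rightarrow> nat \<Rightarrow> nat \<Rightarrow> nat \<Rightarrow> real \<Rightarrow> complex" where
  "spherical a b s q t = (\<Sum>i\<le>a + s. of_real (cg_dist a b s i q)
     * cis (t * (real q - real (a + b) / 2 + real (a + s) - 2 * real i)))"

text \<open>
  Swapping the two components of \<open>a\<^sub>t\<close> gives its inverse.
\<close>

lemma spherical_swap: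
  "spherical b a s q t = cnj (spherical a b s q t)"
proof -
  have "spherical b a s q t = (\<Sum>j | j \<le> b + s \<and> j \<le> q + s \<and> q + s \<le> j + (a + s). of_real (cg_dist b a s j q)
     * cis (t * (real q - real (b + a) / 2 + real (b + s) - 2 * real j)))"
    unfolding spherical_def by (rule sum.mono_neutral_right) (auto dest: cg_dist_nonzero)
  also have "\<dots> = (\<Sum>i | i \<le> a + s \<and> i \<le> q + s \<and> q + s \<le> i + (b + s). of_real (cg_dist a b s i q)
     * cis (- (t * (real q - real (a + b) / 2 + real (a + s) - 2 * real i))))"
  proof (rule sum.reindex_bij_witness[of _ "\<lambda>i. q + s - i" "\<lambda>i. q + s - i"], goal_cases)
    case (5 j)
    then have "cg_dist a b s (q + s - j) q = cg_dist b a s j q"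
      by (intro cg_dist_swap) auto
    moreover have "- (t * (real q - real (a + b) / 2 + real (a + s) - 2 * real (q + s - j)))
        = t * (real q - real (b + a) / 2 + real (b + s) - 2 * real j)"
      using 5 by (simp add: of_nat_diff field_simps)
    ultimately show ?case by (simp only:)
  qed auto
  also have "\<dots> = (\<Sum>i\<le>a + s. of_real (cg_dist a b s i q)
     * cis (- (t * (real q - real (a + b) / 2 + real (a + s) - 2 * real i))))"
    by (rule sum.mono_neutral_left) (auto dest: cg_dist_nonzero)
  finally show ?thesis by (simp add: spherical_def cis_cnj)
qed

lemma spherical_pairing_integral_lt:
  assumes p: "p \<le> L" "p' \<le> L" and lt: "p + s < p' + s'"
  shows "((\<lambda>t. (\<Sum>q\<le>L. spherical p (L - p) s q t * cnj (spherical p' (L - p') s' q t)) * of_real ((sin t)\<^sup>2))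
     has_integral 0) {0..pi}"
proof -
  define D where "D = cg_dist p (L - p) s"
  define D' where "D' = cg_dist p' (L - p') s'"
  define N where "N = p + s"
  define N' where "N' = p' + s'"
  define M where "M i j = (\<Sum>q\<le>L. complex_of_real (D i q * D' j q))" for i j
  have "(\<Sum>i\<le>N. M i (i + c + 1)) = (\<Sum>i\<le>N. M i (i + c))" if "N + c + 1 \<le> N'" for c
  proof -
    have "of_real (\<Sum>q\<le>L. \<Sum>i\<le>N. D i q * (D' (i + c + 1) q - D' (i + c) q)) = (0 :: complex)"
      using trace_shift[of p L p' s c s'] p that unfolding D_def D'_def N_def N'_def by simp
    then have "(\<Sum>q\<le>L. \<Sum>i\<le>N. complex_of_real (D i q * D' (i + c + 1) q))
        = (\<Sum>q\<le>L. \<Sum>i\<le>N. complex_of_real (D i q * D' (i + c) q))"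
      by (simp add: right_diff_distrib sum_subtractf)
    then show ?thesis unfolding M_def by (subst (1 2) sum.swap)
  qed
  moreover have "M (N - i) (N' - j) = M i j" if "i \<le> N" "j \<le> N'" for i j
    unfolding M_def
  proof (rule sum.reindex_bij_witness[of _ "\<lambda>q. L - q" "\<lambda>q. L - q"], goal_cases)
    case (5 q)
    then have "D (N - i) q = D i (L - q)" "D' (N' - j) q = D' j (L - q)"
      using cg_dist_flip[of i p s "L - q" "L - p"] cg_dist_flip[of j p' s' "L - q" "L - p'"] p that
      unfolding D_def D'_def N_def N'_def by simp_all
    then show ?case by simp
  qed auto
  ultimately have zero: "(\<Sum>i\<le>N. \<Sum>j\<le>N'. M i j * sin2_coeff (int N - int N' - 2 * int i + 2 * int j)) = 0"
    using lt by (intro sin2_pairing_zero) (auto simp: N_def N'_def)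
  have "(\<Sum>q\<le>L. spherical p (L - p) s q t * cnj (spherical p' (L - p') s' q t)) * of_real ((sin t)\<^sup>2)
     = (\<Sum>i\<le>N. \<Sum>j\<le>N'. M i j *
         (cis (real_of_int (int N - int N' - 2 * int i + 2 * int j) * t) * of_real ((sin t)\<^sup>2)))" for t
  proof -
    define x where "x q i = cis (t * (real q - real L / 2 + real N - 2 * real i))" for q i
    define y where "y q j = cis (- (t * (real q - real L / 2 + real N' - 2 * real j)))" for q j
    have xy: "x q i * y q j = cis (real_of_int (int N - int N' - 2 * int i + 2 * int j) * t)" for q i j
      unfolding x_def y_def cis_mult by (rule arg_cong[where f = cis]) (simp add: algebra_simps)
    have "spherical p (L - p) s q t = (\<Sum>i\<le>N. of_real (D i q) * x q i)" for q
      using p by (simp add: spherical_def D_def N_def x_def)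
    moreover have "cnj (spherical p' (L - p') s' q t) = (\<Sum>j\<le>N'. of_real (D' j q) * y q j)" for q
      using p by (simp add: spherical_def D'_def N'_def y_def cis_cnj)
    ultimately have "(\<Sum>q\<le>L. spherical p (L - p) s q t * cnj (spherical p' (L - p') s' q t)) * of_real ((sin t)\<^sup>2)
      = (\<Sum>q\<le>L. \<Sum>i\<le>N. \<Sum>j\<le>N'. of_real (D i q * D' j q) * ((x q i * y q j) * of_real ((sin t)\<^sup>2)))"
      by (simp only: sum_product) (simp only: sum_distrib_right, simp only: of_real_mult mult_ac)
    also have "\<dots> = (\<Sum>i\<le>N. \<Sum>q\<le>L. \<Sum>j\<le>N'. of_real (D i q * D' j q) * ((x q i * y q j) * of_real ((sin t)\<^sup>2)))"
      by (rule sum.swap)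
    also have "\<dots> = (\<Sum>i\<le>N. \<Sum>j\<le>N'. \<Sum>q\<le>L. of_real (D i q * D' j q) * ((x q i * y q j) * of_real ((sin t)\<^sup>2)))"
      by (intro sum.cong refl sum.swap)
    finally show ?thesis unfolding xy M_def sum_distrib_right .
  qed
  moreover have "((\<lambda>t. \<Sum>i\<le>N. \<Sum>j\<le>N'. M i j *
         (cis (real_of_int (int N - int N' - 2 * int i + 2 * int j) * t) * of_real ((sin t)\<^sup>2)))
     has_integral (\<Sum>i\<le>N. \<Sum>j\<le>N'. M i j * sin2_coeff (int N - int N' - 2 * int i + 2 * int j))) {0..pi}"
    by (intro has_integral_sum has_integral_mult_right sin2_coeff_has_integral finite_atMost)
  ultimately show ?thesis unfolding zero by simp
qed

text \<open>
  If the first spins agree, then the second ones differ, and conjugation interchanges the two.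
\<close>

lemma spherical_pairing_integral:
  assumes p: "p \<le> L" "p' \<le> L" and ne: "s \<noteq> s'"
  shows "((\<lambda>t. (\<Sum>q\<le>L. spherical p (L - p) s q t * cnj (spherical p' (L - p') s' q t)) * of_real ((sin t)\<^sup>2))
     has_integral 0) {0..pi}"
proof -
  define G where "G p s p' s' t = (\<Sum>q\<le>L. spherical p (L - p) s q t * cnj (spherical p' (L - p') s' q t))
    * of_real ((sin t)\<^sup>2)" for p s p' s' t
  have cnj: "(G p' s' p s has_integral 0) {0..pi}" if "(G p s p' s' has_integral 0) {0..pi}" for p s p' s'
  proof -
    have "cnj \<circ> G p s p' s' = G p' s' p s" by (auto simp: G_def mult.commute)
    with has_integral_cnj[of "G p s p' s'" 0] that show ?thesis by simp
  qed
  have neq: "(G p s p' s' has_integral 0) {0..pi}" if "p \<le> L" "p' \<le> L" "p + s \<noteq> p' + s'" for p s p' s'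
  proof (cases "p + s < p' + s'")
    case True
    then show ?thesis using spherical_pairing_integral_lt[of p L p' s s'] that by (simp add: G_def[abs_def])
  next
    case False
    then have "(G p' s' p s has_integral 0) {0..pi}"
      using spherical_pairing_integral_lt[of p' L p s' s] that by (simp add: G_def[abs_def])
    then show ?thesis by (rule cnj)
  qed
  have "(G p s p' s' has_integral 0) {0..pi}"
  proof (cases "p + s = p' + s'")
    case False
    then show ?thesis using neq p by blast
  next
    case True
    have "(G (L - p') s' (L - p) s has_integral 0) {0..pi}"
      using True p ne by (intro neq) auto
    moreover have "G (L - p') s' (L - p) s = G p s p' s'"
      using p spherical_swap[of "L - p" p s] spherical_swap[of "L - p'" p' s']
      by (auto simp: G_def mult.commute)
    ultimately show ?thesis by simp
  qed
  then show ?thesis by (simp add: G_def[abs_def])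
qed

section \<open>Spherical functions on the torus\<close>

lemma psi_independent:
  assumes zero: "\<And>v. v \<in> carrier_vec 2 \<Longrightarrow> (\<Sum>m\<le>L. c m * psi L m v) = 0" and m: "m \<le> L"
  shows "c m = 0"
proof -
  define P where "P = (\<Sum>m\<le>L. monom (c m * complex_of_real (sqrt (real (L choose (L - m))))) m)"
  have "poly P z = 0" for z
  proof -
    define v :: "complex Matrix.vec" where "v = Matrix.vec 2 (\<lambda>i. if i = 0 then 1 else z)"
    have "(\<Sum>m\<le>L. c m * psi L m v) = 0" by (rule zero) (simp add: v_def)
    then show ?thesis by (simp add: P_def v_def psi_def poly_sum poly_monom mult_ac)
  qed
  then have "P = 0" using poly_all_0_iff_0 by blast
  then have "poly.coeff P m = 0" by simp
  moreover have "poly.coeff P m = c m * complex_of_real (sqrt (real (L choose (L - m))))"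
    using m by (simp add: P_def coeff_sum)
  moreover have "L choose (L - m) \<noteq> 0" by (simp add: binomial_eq_0_iff)
  ultimately show ?thesis by simp
qed

lemma T_rep_eqI:
  assumes A: "A \<in> carrier_mat (L + 1) (L + 1)"
    and act: "\<And>n v. n \<le> L \<Longrightarrow> v \<in> carrier_vec 2 \<Longrightarrow> act k (psi L n) v = (\<Sum>m\<le>L. A $$ (m, n) * psi L m v)"
  shows "T_rep L k = A"
  unfolding T_rep_def
proof (rule the_equality)
  show "A \<in> carrier_mat (L + 1) (L + 1) \<and>
     (\<forall>n\<le>L. \<forall>v\<in>carrier_vec 2. act k (psi L n) v = (\<Sum>m\<le>L. A $$ (m, n) * psi L m v))"
    using A act by blast
next
  fix B assume B: "B \<in> carrier_mat (L + 1) (L + 1) \<and>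
     (\<forall>n\<le>L. \<forall>v\<in>carrier_vec 2. act k (psi L n) v = (\<Sum>m\<le>L. B $$ (m, n) * psi L m v))"
  have "B $$ (m, n) - A $$ (m, n) = 0" if "m \<le> L" "n \<le> L" for m n
  proof (rule psi_independent[where c = "\<lambda>m. B $$ (m, n) - A $$ (m, n)"])
    fix v :: "complex Matrix.vec" assume v: "v \<in> carrier_vec 2"
    have "(\<Sum>m\<le>L. B $$ (m, n) * psi L m v) = (\<Sum>m\<le>L. A $$ (m, n) * psi L m v)"
      using B act[OF that(2) v] that v by metis
    then show "(\<Sum>m\<le>L. (B $$ (m, n) - A $$ (m, n)) * psi L m v) = 0"
      by (simp add: left_diff_distrib sum_subtractf)
  qed (use that in simp)
  then show "B = A" using A B by (intro eq_matI) auto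
qed

text \<open>
  The description that defines \<open>T_rep\<close> determines the matrix, because the basis functions are
  linearly independent; on the torus they are weight vectors.
\<close>

lemma T_rep_torus:
  "T_rep L (m_elt t) = Matrix.mat (L + 1) (L + 1)
     (\<lambda>(m, n). if m = n then cis (t * (real L - 2 * real n) / 2) else 0)"
proof (rule T_rep_eqI)
  fix n and v :: "complex Matrix.vec"
  assume n: "n \<le> L" and v: "v \<in> carrier_vec 2"
  have d: "dim_vec v = 2" using v by simp
  have e: "exp (\<i> * of_real t / 2) = cis (t / 2)" "exp (- \<i> * of_real t / 2) = cis (- t / 2)"
    by (simp_all add: cis_conv_exp)
  have i0: "vec_index (transpose_mat (m_elt t) *\<^sub>v v) 0 = cis (t / 2) * vec_index v 0"
    and i1: "vec_index (transpose_mat (m_elt t) *\<^sub>v v) 1 = cis (- t / 2) * vec_index v 1"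
    unfolding m_elt_def e using d
    by (simp_all add: scalar_prod_def mat_of_rows_list_def numeral_2_eq_2)
  have c: "cis (t / 2) ^ (L - n) * cis (- t / 2) ^ n = cis (t * (real L - 2 * real n) / 2)"
  proof -
    have "real (L - n) * (t / 2) + real n * (- t / 2) = t * (real L - 2 * real n) / 2"
      using n by (simp add: of_nat_diff field_simps)
    then show ?thesis by (simp only: Complex.DeMoivre cis_mult)
  qed
  have "act (m_elt t) (psi L n) v = (cis (t / 2) ^ (L - n) * cis (- t / 2) ^ n) * psi L n v"
    unfolding act_def psi_def i0 i1 by (simp add: power_mult_distrib)
  also have "\<dots> = (\<Sum>m\<le>L. (if m = n then cis (t * (real L - 2 * real n) / 2) else 0) * psi L m v)"
    using n unfolding c by (simp add: if_distrib[where f = "\<lambda>x. x * _"] cong: if_cong)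
  also have "\<dots> = (\<Sum>m\<le>L. Matrix.mat (L + 1) (L + 1)
     (\<lambda>(m, n). if m = n then cis (t * (real L - 2 * real n) / 2) else 0) $$ (m, n) * psi L m v)"
    using n by (intro sum.cong refl) simp
  finally show "act (m_elt t) (psi L n) v = (\<Sum>m\<le>L. Matrix.mat (L + 1) (L + 1)
     (\<lambda>(m, n). if m = n then cis (t * (real L - 2 * real n) / 2) else 0) $$ (m, n) * psi L m v)" .
qed simp

lemma Phi_torus:
  assumes q: "q \<le> a + b"
  shows "Phi (a + b) (a + s) (b + s) (a_elt t) $$ (q, q) = spherical a b s q t"
proof -
  define C where "C m1 m2 = clebsch_gordan (a + s) (b + s) (a + b) m1 m2 q" for m1 m2
  define x where "x m = cis (t * (real (a + s) - 2 * real m) / 2)" for m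
  define y where "y m = cis (- t * (real (b + s) - 2 * real m) / 2)" for m
  have T1: "T_rep (a + s) (m_elt t) $$ (m, n) = (if m = n then x n else 0)"
    if "m \<le> a + s" "n \<le> a + s" for m n using that by (simp add: T_rep_torus x_def)
  have T2: "T_rep (b + s) (m_elt (- t)) $$ (m, n) = (if m = n then y n else 0)"
    if "m \<le> b + s" "n \<le> b + s" for m n using that by (simp add: T_rep_torus y_def)
  have "Phi (a + b) (a + s) (b + s) (a_elt t) $$ (q, q)
    = (\<Sum>m1\<le>a + s. \<Sum>m2\<le>b + s. \<Sum>n1\<le>a + s. \<Sum>n2\<le>b + s.
       of_real (C m1 m2) * ((if m1 = n1 then x n1 else 0) * (if m2 = n2 then y n2 else 0)) * of_real (C n1 n2))"
    using q T1 T2 by (simp add: Phi_def a_elt_def sum.cartesian_product[symmetric] beta_def C_def)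
  also have "\<dots> = (\<Sum>m1\<le>a + s. \<Sum>m2\<le>b + s. of_real ((C m1 m2)\<^sup>2) * (x m1 * y m2))"
  proof (intro sum.cong refl)
    fix m1 m2 assume m: "m1 \<in> {..a + s}" "m2 \<in> {..b + s}"
    have "(\<Sum>n1\<le>a + s. \<Sum>n2\<le>b + s.
       of_real (C m1 m2) * ((if m1 = n1 then x n1 else 0) * (if m2 = n2 then y n2 else 0)) * of_real (C n1 n2))
      = (\<Sum>n1\<le>a + s. if n1 = m1 then of_real (C m1 m2) * (x m1 * y m2) * of_real (C m1 m2) else 0)"
    proof (rule sum.cong[OF refl])
      fix n1
      have "(\<Sum>n2\<le>b + s.
         of_real (C m1 m2) * ((if m1 = n1 then x n1 else 0) * (if m2 = n2 then y n2 else 0)) * of_real (C n1 n2))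
        = (\<Sum>n2\<le>b + s. if n2 = m2 then
            (if n1 = m1 then of_real (C m1 m2) * (x m1 * y m2) * of_real (C m1 m2) else 0) else 0)"
        by (intro sum.cong refl) simp
      then show "(\<Sum>n2\<le>b + s.
         of_real (C m1 m2) * ((if m1 = n1 then x n1 else 0) * (if m2 = n2 then y n2 else 0)) * of_real (C n1 n2))
        = (if n1 = m1 then of_real (C m1 m2) * (x m1 * y m2) * of_real (C m1 m2) else 0)"
        using m by simp
    qed
    also have "\<dots> = of_real ((C m1 m2)\<^sup>2) * (x m1 * y m2)"
      using m by (simp add: power2_eq_square)
    finally show "(\<Sum>n1\<le>a + s. \<Sum>n2\<le>b + s.
       of_real (C m1 m2) * ((if m1 = n1 then x n1 else 0) * (if m2 = n2 then y n2 else 0)) * of_real (C n1 n2))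
      = of_real ((C m1 m2)\<^sup>2) * (x m1 * y m2)" .
  qed
  also have "\<dots> = spherical a b s q t"
    unfolding spherical_def
  proof (rule sum.cong[OF refl])
    fix m1 assume m1: "m1 \<in> {..a + s}"
    have "(\<Sum>m2\<le>b + s. of_real ((C m1 m2)\<^sup>2) * (x m1 * y m2))
      = (\<Sum>m2\<le>b + s. if m1 + m2 = q + s then of_real (cg_dist a b s m1 q) * (x m1 * y m2) else 0)"
      using m1 q by (intro sum.cong refl) (simp add: C_def clebsch_gordan_squared del: of_real_power)
    also have "\<dots> = of_real (cg_dist a b s m1 q)
        * cis (t * (real q - real (a + b) / 2 + real (a + s) - 2 * real m1))"
    proof (cases "m1 \<le> q + s \<and> q + s \<le> m1 + (b + s)")
      case True
      then have "(m1 + m2 = q + s) = (m2 = q + s - m1)" for m2 by auto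
      moreover have "x m1 * y (q + s - m1) = cis (t * (real q - real (a + b) / 2 + real (a + s) - 2 * real m1))"
      proof -
        have "t * (real (a + s) - 2 * real m1) / 2 + - t * (real (b + s) - 2 * real (q + s - m1)) / 2
            = t * (real q - real (a + b) / 2 + real (a + s) - 2 * real m1)"
          using True by (simp add: of_nat_diff field_simps)
        then show ?thesis by (simp only: x_def y_def cis_mult)
      qed
      ultimately show ?thesis using True by (auto simp: sum.delta')
    next
      case False
      then have "cg_dist a b s m1 q = 0" by (intro cg_dist_eq_0) auto
      then show ?thesis by simp
    qed
    finally show "(\<Sum>m2\<le>b + s. of_real ((C m1 m2)\<^sup>2) * (x m1 * y m2)) = of_real (cg_dist a b s m1 q)
        * cis (t * (real q - real (a + b) / 2 + real (a + s) - 2 * real m1))" .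
  qed
  finally show ?thesis .
qed

lemma full_spherical_torus:
  "full_spherical L d (a_elt t) = Matrix.mat (L + 1) (L + 1) (\<lambda>(p, q). spherical p (L - p) d q t)"
proof (rule eq_matI)
  fix p q assume "p < dim_row (Matrix.mat (L + 1) (L + 1) (\<lambda>(p, q). spherical p (L - p) d q t))"
    "q < dim_col (Matrix.mat (L + 1) (L + 1) (\<lambda>(p, q). spherical p (L - p) d q t))"
  then have "p \<le> L" "q \<le> L" by auto
  then show "full_spherical L d (a_elt t) $$ (p, q)
      = Matrix.mat (L + 1) (L + 1) (\<lambda>(p, q). spherical p (L - p) d q t) $$ (p, q)"
    using Phi_torus[of q p "L - p" d t] by (simp add: full_spherical_def zeta_def add.commute)
qed (simp_all add: full_spherical_def)

text \<open>
  For \<open>s = 0\<close> the target is the top component, and the squared coefficients form a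
  hypergeometric distribution.
\<close>

lemma cg_dist_stretched:
  assumes "i \<le> a" "j \<le> b"
  shows "cg_dist a b 0 i (i + j) * real ((a + b) choose (i + j)) = real (a choose i) * real (b choose j)"
proof -
  have R: "racah a b 0 (int i) (int j) = 1 / (fact (a - i) * fact j * fact i * fact (b - j))"
  proof -
    have r: "rfact (int x - int y) = 1 / fact (x - y)" if "y \<le> x" for x y
      unfolding of_nat_diff[OF that, symmetric] by (rule rfact_of_nat)
    have "rfact 0 = 1" by (simp add: rfact_def)
    then show ?thesis by (simp add: racah_def r[OF assms(1)] r[OF assms(2)])
  qed
  have f: "fact (a + b + 0 + 1) = (real (a + b + 1) * fact (a + b))"
    by (simp only: add_0_right Suc_eq_plus1[symmetric] fact_Suc)
  have ring: "n * (fa * fb * 1 / (n * fab)) * (fq * fq') * (A * A') * (B * B') * (1 / (A' * B * A * B'))\<^sup>2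
      * (fab / (fq * fq')) = fa / (A * A') * (fb / (B * B'))"
    if "n \<noteq> 0" "fab \<noteq> 0" "fq \<noteq> 0" "fq' \<noteq> 0" "A \<noteq> 0" "A' \<noteq> 0" "B \<noteq> 0" "B' \<noteq> 0"
    for n fa fb fab fq fq' A A' B B' :: real
    using that by (simp add: power2_eq_square)
  have b: "real ((a + b) choose (i + j)) = fact (a + b) / (fact (i + j) * fact (a + b - (i + j)))"
    "real (a choose i) = fact a / (fact i * fact (a - i))" "real (b choose j) = fact b / (fact j * fact (b - j))"
    by (rule binomial_fact[OF add_mono[OF assms]] binomial_fact[OF assms(1)] binomial_fact[OF assms(2)])+
  have "int (i + j) + int 0 - int i = int j" "i + j + 0 - i = j" "a + 0 = a" "b + 0 = b" by simp_all
  note e = this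
  show ?thesis
    unfolding b cg_dist_def fact_weight_def e R f fact_0
    by (rule ring) (simp_all only: fact_nonzero of_nat_eq_0_iff add_is_0 one_neq_zero simp_thms)
qed

text \<open>
  Row \<open>a\<close> of \<open>\<Phi>\<^sub>0(a\<^sub>t)\<close>, scaled by binomial coefficients, consists of the coefficients of a product of
  powers of two linear forms: \<open>\<Phi>\<^sub>0(a\<^sub>t)\<close> is essentially a symmetric power of a
  \<open>2 \<times> 2\<close> matrix with determinant \<open>2 \<i> sin t\<close>.
\<close>

lemma spherical_generating_function:
  "(\<Sum>q\<le>a + b. of_nat ((a + b) choose q) * spherical a b 0 q t * z ^ q)
    = (cis (t / 2) + cis (- t / 2) * z) ^ a * (cis (- t / 2) + cis (t / 2) * z) ^ b"
proof -
  define e where "e i q = cis (t * (real q - real (a + b) / 2 + real a - 2 * real i))" for i q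
  have "(\<Sum>q\<le>a + b. of_nat ((a + b) choose q) * spherical a b 0 q t * z ^ q)
     = (\<Sum>q\<le>a + b. \<Sum>i\<le>a. of_real (cg_dist a b 0 i q * real ((a + b) choose q)) * e i q * z ^ q)"
    by (simp add: spherical_def sum_distrib_left sum_distrib_right e_def mult_ac)
  also have "\<dots> = (\<Sum>i\<le>a. \<Sum>q\<le>a + b. of_real (cg_dist a b 0 i q * real ((a + b) choose q)) * e i q * z ^ q)"
    by (rule sum.swap)
  also have "\<dots> = (\<Sum>i\<le>a. \<Sum>j\<le>b. (of_nat (a choose i) * (cis (- t / 2) * z) ^ i * cis (t / 2) ^ (a - i))
       * (of_nat (b choose j) * (cis (t / 2) * z) ^ j * cis (- t / 2) ^ (b - j)))"
  proof (rule sum.cong[OF refl])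
    fix i assume i: "i \<in> {..a}"
    have "(\<Sum>q\<le>a + b. of_real (cg_dist a b 0 i q * real ((a + b) choose q)) * e i q * z ^ q)
      = (\<Sum>q\<in>{i..i + b}. of_real (cg_dist a b 0 i q * real ((a + b) choose q)) * e i q * z ^ q)"
      using i by (intro sum.mono_neutral_right) (auto dest: cg_dist_nonzero)
    also have "\<dots> = (\<Sum>j\<le>b. of_real (cg_dist a b 0 i (i + j) * real ((a + b) choose (i + j))) * e i (i + j) * z ^ (i + j))"
      by (rule sum.reindex_bij_witness[of _ "\<lambda>j. i + j" "\<lambda>q. q - i"]) auto
    also have "\<dots> = (\<Sum>j\<le>b. (of_nat (a choose i) * (cis (- t / 2) * z) ^ i * cis (t / 2) ^ (a - i))
       * (of_nat (b choose j) * (cis (t / 2) * z) ^ j * cis (- t / 2) ^ (b - j)))"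
    proof (rule sum.cong[OF refl])
      fix j assume j: "j \<in> {..b}"
      have "e i (i + j) = (cis (- t / 2) ^ i * cis (t / 2) ^ (a - i)) * (cis (t / 2) ^ j * cis (- t / 2) ^ (b - j))"
      proof -
        have "t * (real (i + j) - real (a + b) / 2 + real a - 2 * real i)
            = real i * (- t / 2) + real (a - i) * (t / 2) + (real j * (t / 2) + real (b - j) * (- t / 2))"
          using i j by (simp add: of_nat_diff field_simps)
        then show ?thesis by (simp only: e_def Complex.DeMoivre cis_mult)
      qed
      moreover have cg: "complex_of_real (cg_dist a b 0 i (i + j) * real ((a + b) choose (i + j)))
          = of_nat (a choose i) * of_nat (b choose j)"
        using cg_dist_stretched[of i a j b] i j by (simp only: atMost_iff of_real_mult of_real_of_nat_eq)
      ultimately show "of_real (cg_dist a b 0 i (i + j) * real ((a + b) choose (i + j))) * e i (i + j) * z ^ (i + j)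
        = (of_nat (a choose i) * (cis (- t / 2) * z) ^ i * cis (t / 2) ^ (a - i))
       * (of_nat (b choose j) * (cis (t / 2) * z) ^ j * cis (- t / 2) ^ (b - j))"
        unfolding cg by (simp only: power_mult_distrib power_add mult_ac)
    qed
    finally show "(\<Sum>q\<le>a + b. of_real (cg_dist a b 0 i q * real ((a + b) choose q)) * e i q * z ^ q)
       = (\<Sum>j\<le>b. (of_nat (a choose i) * (cis (- t / 2) * z) ^ i * cis (t / 2) ^ (a - i))
       * (of_nat (b choose j) * (cis (t / 2) * z) ^ j * cis (- t / 2) ^ (b - j)))" .
  qed
  also have "\<dots> = (cis (t / 2) + cis (- t / 2) * z) ^ a * (cis (- t / 2) + cis (t / 2) * z) ^ b"
    unfolding sum_product[symmetric] add.commute[of "cis _" "_ * z"] binomial_ring ..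
  finally show ?thesis .
qed

text \<open>
  A vector annihilated from the left gives a homogeneous polynomial in the two linear forms of
  \<open>spherical_generating_function\<close>, of degree \<open>L\<close>, that vanishes identically.  As \<open>sin t \<noteq> 0\<close>,
  the forms are independent, their quotient takes all values but one, and all coefficients are zero.
\<close>

lemma det_full_spherical_0:
  assumes "sin t \<noteq> 0"
  shows "Determinant.det (full_spherical L 0 (a_elt t)) \<noteq> 0"
proof
  define F where "F = full_spherical L 0 (a_elt t)"
  define u where "u = cis (t / 2)"
  define u' where "u' = cis (- t / 2)"
  have F: "F \<in> carrier_mat (L + 1) (L + 1)" by (simp add: F_def full_spherical_def)
  assume "Determinant.det (full_spherical L 0 (a_elt t)) = 0"
  then have "Determinant.det (transpose_mat F) = 0" using F by (simp add: det_transpose F_def)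
  then obtain v where v: "v \<in> carrier_vec (L + 1)" "v \<noteq> 0\<^sub>v (L + 1)"
    and Fv: "transpose_mat F *\<^sub>v v = 0\<^sub>v (L + 1)"
    using det_0_iff_vec_prod_zero[of "transpose_mat F" "L + 1"] F by auto
  define c where "c p = vec_index v p" for p
  have zero: "(\<Sum>p\<le>L. c p * spherical p (L - p) 0 q t) = 0" if q: "q \<le> L" for q
  proof -
    have "0 = vec_index (transpose_mat F *\<^sub>v v) q" using Fv q by simp
    also have "\<dots> = (\<Sum>p\<in>{0..<L + 1}. F $$ (p, q) * vec_index v p)"
      using F v q by (simp add: scalar_prod_def)
    also have "\<dots> = (\<Sum>p\<le>L. c p * spherical p (L - p) 0 q t)"
      using q by (intro sum.cong) (auto simp: F_def full_spherical_torus c_def)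
    finally show ?thesis by simp
  qed
  have gen: "(\<Sum>p\<le>L. c p * ((u + u' * z) ^ p * (u' + u * z) ^ (L - p))) = 0" for z
  proof -
    have "(\<Sum>p\<le>L. c p * ((u + u' * z) ^ p * (u' + u * z) ^ (L - p)))
      = (\<Sum>p\<le>L. c p * (\<Sum>q\<le>L. of_nat (L choose q) * spherical p (L - p) 0 q t * z ^ q))"
    proof (rule sum.cong[OF refl])
      fix p assume "p \<in> {..L}"
      then show "c p * ((u + u' * z) ^ p * (u' + u * z) ^ (L - p))
        = c p * (\<Sum>q\<le>L. of_nat (L choose q) * spherical p (L - p) 0 q t * z ^ q)"
        using spherical_generating_function[of p "L - p" t z] by (simp add: u_def u'_def)
    qed
    also have "\<dots> = (\<Sum>q\<le>L. \<Sum>p\<le>L. of_nat (L choose q) * z ^ q * (c p * spherical p (L - p) 0 q t))"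
      unfolding sum_distrib_left by (subst sum.swap) (simp add: mult_ac)
    also have "\<dots> = 0" by (simp add: sum_distrib_left[symmetric] zero)
    finally show ?thesis .
  qed
  have uu: "u * u - u' * u' \<noteq> 0"
  proof -
    have "u * u = cis t" "u' * u' = cis (- t)" by (simp_all add: u_def u'_def cis_mult)
    then show ?thesis using assms by (simp add: complex_eq_iff)
  qed
  have u1: "u * u' = 1" by (simp add: u_def u'_def cis_mult)
  define P where "P = (\<Sum>p\<le>L. monom (c p) p)"
  have P: "poly P w = 0" if "w \<noteq> u' * u'" for w
  proof -
    \<comment> \<open>The solution of \<open>(u + u' z) / (u' + u z) = w\<close>.\<close>
    define z where "z = (u - w * u') / (w * u - u')"
    have nz: "w * u - u' \<noteq> 0"
    proof
      assume "w * u - u' = 0"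
      then have "w * (u * u') = u' * u'" by (simp add: algebra_simps)
      with that u1 show False by simp
    qed
    have zz: "z * (w * u - u') = u - w * u'" using nz by (simp add: z_def)
    have A: "u + u' * z = w * (u' + u * z)" using zz by (simp add: algebra_simps)
    have "(u' + u * z) * (w * u - u') = u * u - u' * u'"
    proof -
      have "(u' + u * z) * (w * u - u') = u' * (w * u - u') + u * (z * (w * u - u'))"
        by (simp add: algebra_simps)
      then show ?thesis unfolding zz by (simp add: algebra_simps)
    qed
    then have B: "u' + u * z \<noteq> 0" using uu by auto
    have "0 = (\<Sum>p\<le>L. c p * ((w * (u' + u * z)) ^ p * (u' + u * z) ^ (L - p)))"
      using gen[of z] unfolding A by simp
    also have "\<dots> = (\<Sum>p\<le>L. (u' + u * z) ^ L * (c p * w ^ p))"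
    proof (rule sum.cong[OF refl])
      fix p assume "p \<in> {..L}"
      then have "(u' + u * z) ^ L = (u' + u * z) ^ p * (u' + u * z) ^ (L - p)"
        by (simp flip: power_add)
      then show "c p * ((w * (u' + u * z)) ^ p * (u' + u * z) ^ (L - p)) = (u' + u * z) ^ L * (c p * w ^ p)"
        by (simp add: power_mult_distrib)
    qed
    also have "\<dots> = (u' + u * z) ^ L * poly P w"
      by (simp add: P_def poly_sum poly_monom sum_distrib_left)
    finally show ?thesis using B by simp
  qed
  have "P = 0"
  proof (rule ccontr)
    assume "P \<noteq> 0"
    then have "finite {w. poly P w = 0}" by (rule poly_roots_finite)
    then have "finite (UNIV - {u' * u'})" by (rule finite_subset[rotated]) (auto simp: P)
    then show False by (simp add: infinite_UNIV_char_0)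
  qed
  have "c p = 0" if "p \<le> L" for p
  proof -
    have "c p = poly.coeff P p" using that by (simp add: P_def coeff_sum)
    then show ?thesis using \<open>P = 0\<close> by simp
  qed
  then have "v = 0\<^sub>v (L + 1)" using v(1) by (intro eq_vecI) (auto simp: c_def)
  with v(2) show False by simp
qed

section \<open>The matrix-valued inner product\<close>

lemma mat_adjoint_carrier:
  assumes "A \<in> carrier_mat n m" shows "mat_adjoint A \<in> carrier_mat m n"
  using assms unfolding mat_adjoint_def by (auto simp: mat_of_rows_def)

lemma mat_adjoint_index:
  fixes A :: "complex Matrix.mat"
  assumes "A \<in> carrier_mat n m" "i < m" "j < n"
  shows "mat_adjoint A $$ (i, j) = cnj (A $$ (j, i))"
  using assms unfolding mat_adjoint_def
  by (simp add: mat_of_rows_index)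

lemma mult_mat_index:
  fixes A B :: "complex Matrix.mat"
  assumes "A \<in> carrier_mat (L + 1) (L + 1)" "B \<in> carrier_mat (L + 1) (L + 1)" "i \<le> L" "j \<le> L"
  shows "(A * B) $$ (i, j) = (\<Sum>k\<le>L. A $$ (i, k) * B $$ (k, j))"
  using assms by (simp add: scalar_prod_def atLeast0LessThan lessThan_Suc_atMost)

lemma mat_adjoint_mult:
  fixes A B :: "complex Matrix.mat"
  assumes A: "A \<in> carrier_mat (L + 1) (L + 1)" and B: "B \<in> carrier_mat (L + 1) (L + 1)"
  shows "mat_adjoint (A * B) = mat_adjoint B * mat_adjoint A"
proof (rule eq_matI)
  note A' = mat_adjoint_carrier[OF A] and B' = mat_adjoint_carrier[OF B]
  note AB = mult_carrier_mat[OF A B]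
  show "dim_row (mat_adjoint (A * B)) = dim_row (mat_adjoint B * mat_adjoint A)"
    "dim_col (mat_adjoint (A * B)) = dim_col (mat_adjoint B * mat_adjoint A)"
    using A' B' mat_adjoint_carrier[OF AB] by auto
  fix i j assume "i < dim_row (mat_adjoint B * mat_adjoint A)" "j < dim_col (mat_adjoint B * mat_adjoint A)"
  then have ij: "i \<le> L" "j \<le> L" using A' B' by auto
  then show "mat_adjoint (A * B) $$ (i, j) = (mat_adjoint B * mat_adjoint A) $$ (i, j)"
    using ij by (simp add: mult_mat_index[OF B' A'] mat_adjoint_index[OF AB] mult_mat_index[OF A B]
        mat_adjoint_index[OF A] mat_adjoint_index[OF B] mult.commute)
qed

text \<open>
  The factors \<open>\<Phi>\<^sub>0\<close> of the weight cancel against their inverses in \<open>Q\<^sub>d\<close> and \<open>Q\<^sub>d\<^sub>'\<close>.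
\<close>

lemma ip_integrand_entry:
  fixes L d d' n m :: nat and x :: real
  assumes x: "-1 < x" "x < 1" and nm: "n \<le> L" "m \<le> L"
  defines "t \<equiv> arccos x" and "U \<equiv> minv (Upsilon L d)" and "U' \<equiv> minv (Upsilon L d')"
  shows "ip_integrand L (P_monic L d) (P_monic L d') x $$ (n, m)
    = of_real (1 / sqrt (1 - x\<^sup>2)) *
      ((\<Sum>p\<le>L. \<Sum>p'\<le>L. U $$ (n, p) * cnj (U' $$ (m, p')) *
        (\<Sum>q\<le>L. spherical p (L - p) d q t * cnj (spherical p' (L - p') d' q t))) * of_real ((sin t)\<^sup>2))"
proof -
  let ?C = "carrier_mat (L + 1) (L + 1) :: complex Matrix.mat set"
  define F where "F = full_spherical L d (a_elt t)"
  define F' where "F' = full_spherical L d' (a_elt t)"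
  define Z where "Z = full_spherical L 0 (a_elt t)"
  define I where "I = minv Z"
  have F: "F \<in> ?C" and F': "F' \<in> ?C" and Z: "Z \<in> ?C"
    by (simp_all add: F_def F'_def Z_def full_spherical_def)
  have minv_carrier: "minv A \<in> ?C" if "A \<in> ?C" for A
    using adj_mat(1)[OF that] by (simp add: minv_def)
  have "Upsilon L e \<in> ?C" for e by (simp add: Upsilon_def Q_poly_def)
  then have U: "U \<in> ?C" and U': "U' \<in> ?C" unfolding U_def U'_def by (blast intro: minv_carrier)+
  have "sin t \<noteq> 0" unfolding t_def using x by (rule sin_arccos_nonzero)
  then have det: "Determinant.det Z \<noteq> 0" unfolding Z_def by (rule det_full_spherical_0)
  have I: "I \<in> ?C" "I * Z = 1\<^sub>m (L + 1)"
    unfolding I_def using minv[OF Z det] by auto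
  note aF' = mat_adjoint_carrier[OF F'] and aZ = mat_adjoint_carrier[OF Z]
    and aI = mat_adjoint_carrier[OF I(1)] and aU' = mat_adjoint_carrier[OF U']
  note mc = mult_carrier_mat[of _ "L + 1" "L + 1" _ "L + 1"]
  define c where "c = of_real (1 / sqrt (1 - x\<^sup>2)) * (of_real ((sin t)\<^sup>2) :: complex)"
  have IZ: "I * (Z * mat_adjoint Z) * mat_adjoint I = 1\<^sub>m (L + 1)"
  proof -
    have "I * (Z * mat_adjoint Z) * mat_adjoint I = (I * Z) * (mat_adjoint Z * mat_adjoint I)"
      by (simp only: assoc_mult_mat[OF I(1) Z aZ, symmetric] assoc_mult_mat[OF mc[OF I(1) Z] aZ aI])
    also have "mat_adjoint Z * mat_adjoint I = mat_adjoint (I * Z)"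
      by (rule mat_adjoint_mult[OF I(1) Z, symmetric])
    also have "\<dots> = 1\<^sub>m (L + 1)"
      unfolding I(2) using mat_adjoint_carrier[OF one_carrier_mat, of "L + 1"]
      by (intro eq_matI) (auto simp: mat_adjoint_index[OF one_carrier_mat])
    finally show ?thesis by (simp add: I(2))
  qed
  have W: "W_weight L x = c \<cdot>\<^sub>m (Z * mat_adjoint Z)"
    by (rule eq_matI) (auto simp: W_weight_def V_weight_def c_def Z_def t_def)
  have P: "P_monic L d x = U * (F * I)" "P_monic L d' x = U' * (F' * I)"
    by (simp_all add: P_monic_def Q_fun_def U_def U'_def F_def F'_def I_def Z_def t_def)
  have "ip_integrand L (P_monic L d) (P_monic L d') x
      = U * (F * I) * (c \<cdot>\<^sub>m (Z * mat_adjoint Z)) * (mat_adjoint I * mat_adjoint F' * mat_adjoint U')"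
    unfolding ip_integrand_def P W mat_adjoint_mult[OF U' mc[OF F' I(1)]] mat_adjoint_mult[OF F' I(1)] ..
  also have "\<dots> = c \<cdot>\<^sub>m (U * (F * I) * (Z * mat_adjoint Z) * (mat_adjoint I * mat_adjoint F' * mat_adjoint U'))"
    by (simp only: mult_smult_distrib[OF mc[OF U mc[OF F I(1)]] mc[OF Z aZ]]
        mult_smult_assoc_mat[OF mc[OF mc[OF U mc[OF F I(1)]] mc[OF Z aZ]] mc[OF mc[OF aI aF'] aU']])
  also have "U * (F * I) * (Z * mat_adjoint Z) * (mat_adjoint I * mat_adjoint F' * mat_adjoint U')
      = U * F * (I * (Z * mat_adjoint Z) * mat_adjoint I) * (mat_adjoint F' * mat_adjoint U')"
  proof -
    let ?X = "Z * mat_adjoint Z"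
    have X: "?X \<in> ?C" using mc[OF Z aZ] .
    have 1: "U * (F * I) = U * F * I" by (rule assoc_mult_mat[OF U F I(1), symmetric])
    have 2: "mat_adjoint I * mat_adjoint F' * mat_adjoint U' = mat_adjoint I * (mat_adjoint F' * mat_adjoint U')"
      by (rule assoc_mult_mat[OF aI aF' aU'])
    have UF: "U * F \<in> ?C" and FU: "mat_adjoint F' * mat_adjoint U' \<in> ?C"
      using mc[OF U F] mc[OF aF' aU'] by auto
    have 3: "U * F * I * ?X = U * F * (I * ?X)" by (rule assoc_mult_mat[OF UF I(1) X])
    have 4: "U * F * (I * ?X) * (mat_adjoint I * (mat_adjoint F' * mat_adjoint U'))
      = U * F * (I * ?X) * mat_adjoint I * (mat_adjoint F' * mat_adjoint U')"
      by (rule assoc_mult_mat[OF mc[OF UF mc[OF I(1) X]] aI FU, symmetric])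
    have 5: "U * F * (I * ?X) * mat_adjoint I = U * F * (I * ?X * mat_adjoint I)"
      by (rule assoc_mult_mat[OF UF mc[OF I(1) X] aI])
    show ?thesis unfolding 1 2 3 4 5 ..
  qed
  also have "\<dots> = U * (F * mat_adjoint F') * mat_adjoint U'"
    unfolding IZ right_mult_one_mat[OF mc[OF U F]]
    by (simp only: assoc_mult_mat[OF mc[OF U F] aF' aU', symmetric] assoc_mult_mat[OF U F aF'])
  finally have ip: "ip_integrand L (P_monic L d) (P_monic L d') x = c \<cdot>\<^sub>m (U * (F * mat_adjoint F') * mat_adjoint U')" .
  note FF = mc[OF F aF']
  have G: "(F * mat_adjoint F') $$ (p, p')
      = (\<Sum>q\<le>L. spherical p (L - p) d q t * cnj (spherical p' (L - p') d' q t))" if "p \<le> L" "p' \<le> L" for p p'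
    using that unfolding mult_mat_index[OF F aF' that]
    by (intro sum.cong refl) (simp add: mat_adjoint_index[OF F'], simp add: F_def F'_def full_spherical_torus)
  have "(U * (F * mat_adjoint F') * mat_adjoint U') $$ (n, m)
     = (\<Sum>p'\<le>L. (\<Sum>p\<le>L. U $$ (n, p) * (F * mat_adjoint F') $$ (p, p')) * cnj (U' $$ (m, p')))"
    unfolding mult_mat_index[OF mc[OF U FF] aU' nm]
    using nm by (intro sum.cong refl) (simp add: mat_adjoint_index[OF U'] mult_mat_index[OF U FF])
  also have "\<dots> = (\<Sum>p\<le>L. \<Sum>p'\<le>L. U $$ (n, p) * cnj (U' $$ (m, p')) * (F * mat_adjoint F') $$ (p, p'))"
    unfolding sum_distrib_right by (subst sum.swap) (simp add: mult_ac)
  also have "\<dots> = (\<Sum>p\<le>L. \<Sum>p'\<le>L. U $$ (n, p) * cnj (U' $$ (m, p')) *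
        (\<Sum>q\<le>L. spherical p (L - p) d q t * cnj (spherical p' (L - p') d' q t)))"
    by (intro sum.cong refl) (simp add: G)
  finally have E: "(U * (F * mat_adjoint F') * mat_adjoint U') $$ (n, m) = \<dots>" .
  have "(U * (F * mat_adjoint F') * mat_adjoint U') \<in> ?C" by (intro mc U FF aU')
  then have "(c \<cdot>\<^sub>m (U * (F * mat_adjoint F') * mat_adjoint U')) $$ (n, m)
      = c * (U * (F * mat_adjoint F') * mat_adjoint U') $$ (n, m)"
    using nm by (intro index_smult_mat(1)) auto
  then show ?thesis unfolding ip E c_def by (simp only: mult_ac)
qed

text \<open>
  The substitution \<open>x = cos t\<close>.  It is carried out with an antiderivative that is differentiable in the
  interior only, as \<open>arccos\<close> has infinite slope at the ends; the integrand
  itself extends continuously to \<open>[-1, 1]\<close>.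
\<close>

lemma arccos_substitution:
  fixes h :: "real \<Rightarrow> complex"
  assumes h: "continuous_on {0..pi} h"
  defines "g \<equiv> \<lambda>x. of_real (1 / sqrt (1 - x\<^sup>2)) * (h (arccos x) * of_real ((sin (arccos x))\<^sup>2))"
  shows "set_integrable lborel {-1<..<1} g"
    and "(LBINT x:{-1<..<1}. g x) = integral {0..pi} (\<lambda>t. h t * of_real ((sin t)\<^sup>2))"
proof -
  define f where "f t = h t * of_real ((sin t)\<^sup>2)" for t
  define H where "H u = integral {0..u} f" for u
  have f: "continuous_on {0..pi} f" unfolding f_def by (intro continuous_intros h)
  have arccos: "arccos x \<in> {0..pi}" if "x \<in> {-1..1}" for x
    using that arccos_bounded[of x] by auto
  have g: "g x = of_real (sqrt (1 - x\<^sup>2)) * h (arccos x)" if "x \<in> {-1..1}" for x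
  proof (cases "sqrt (1 - x\<^sup>2) = 0")
    case False
    have "(of_real (1 / r) :: complex) * (z * of_real (r\<^sup>2)) = of_real r * z" if "r \<noteq> 0" for r z
      using that by (simp add: power2_eq_square)
    with False show ?thesis using that by (simp add: g_def sin_arccos)
  qed (use that in \<open>simp add: g_def\<close>)
  have "continuous_on {-1..1} (\<lambda>x. of_real (sqrt (1 - x\<^sup>2)) * h (arccos x))"
    by (intro continuous_intros continuous_on_compose2[OF h continuous_on_arccos'] image_subsetI arccos)
  moreover have "continuous_on {-1..1} g \<longleftrightarrow>
      continuous_on {-1..1} (\<lambda>x. of_real (sqrt (1 - x\<^sup>2)) * h (arccos x))"
    by (rule continuous_on_cong[OF refl]) (rule g)
  ultimately have "continuous_on {-1..1} g" by blast
  then have "set_integrable lborel {-1..1} g" by (rule borel_integrable_atLeastAtMost')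
  then show int: "set_integrable lborel {-1<..<1} g"
    by (rule set_integrable_subset) auto
  have "((\<lambda>x. - H (arccos x)) has_vector_derivative g x) (at x)" if x: "x \<in> {-1<..<1}" for x
  proof -
    have b: "0 < arccos x" "arccos x < pi" using x arccos_lt_bounded[of x] by auto
    have "(H has_vector_derivative f (arccos x)) (at (arccos x) within {0..pi})"
      unfolding H_def using b by (intro integral_has_vector_derivative f) auto
    then have "(H has_vector_derivative f (arccos x)) (at (arccos x))"
      using b by (simp add: at_within_Icc_at)
    moreover have "(arccos has_vector_derivative inverse (- sqrt (1 - x\<^sup>2))) (at x)"
      using DERIV_arccos[of x] x by (simp add: has_real_derivative_iff_has_vector_derivative)
    ultimately have "((H \<circ> arccos) has_vector_derivative inverse (- sqrt (1 - x\<^sup>2)) *\<^sub>R f (arccos x)) (at x)"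
      by (intro vector_diff_chain_at)
    then have "((\<lambda>x. - (H \<circ> arccos) x) has_vector_derivative - (inverse (- sqrt (1 - x\<^sup>2)) *\<^sub>R f (arccos x))) (at x)"
      by (rule has_vector_derivative_minus)
    then show ?thesis by (simp add: g_def f_def o_def scaleR_conv_of_real divide_inverse)
  qed
  moreover have "continuous_on {-1..1} (\<lambda>x. - H (arccos x))"
  proof -
    have "continuous_on {0..pi} H"
      unfolding H_def by (intro indefinite_integral_continuous_1 integrable_continuous_real f)
    then have "continuous_on {-1..1} (\<lambda>x. H (arccos x))"
      by (rule continuous_on_compose2[OF _ continuous_on_arccos']) (intro image_subsetI arccos)
    then show ?thesis by (rule continuous_on_minus)
  qed
  ultimately have "(g has_integral - H (arccos 1) - - H (arccos (- 1))) {-1..1}"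
    by (intro fundamental_theorem_of_calculus_interior) auto
  then have "(g has_integral integral {0..pi} f) {-1..1}" by (simp add: H_def)
  then have "(g has_integral integral {0..pi} f) {-1<..<1}" by (simp add: has_integral_Icc_iff_Ioo)
  then show "(LBINT x:{-1<..<1}. g x) = integral {0..pi} (\<lambda>t. h t * of_real ((sin t)\<^sup>2))"
    unfolding set_borel_integral_eq_integral(2)[OF int] f_def by (rule integral_unique)
qed

theorem corollary6p2:
  fixes L d d' :: nat
  assumes "d \<noteq> d'"
  shows "(\<forall>n\<le>L. \<forall>m\<le>L. set_integrable lborel {-1<..<1}
            (\<lambda>x. ip_integrand L (P_monic L d) (P_monic L d') x $$ (n, m)))
       \<and> matrix_ip L (P_monic L d) (P_monic L d') = 0\<^sub>m (L + 1) (L + 1)"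
proof -
  have entry: "set_integrable lborel {-1<..<1} (\<lambda>x. ip_integrand L (P_monic L d) (P_monic L d') x $$ (n, m)) \<and>
      (LBINT x:{-1<..<1}. ip_integrand L (P_monic L d) (P_monic L d') x $$ (n, m)) = 0"
    if nm: "n \<le> L" "m \<le> L" for n m
  proof -
    define u where "u p p' = minv (Upsilon L d) $$ (n, p) * cnj (minv (Upsilon L d') $$ (m, p'))" for p p'
    define G where "G p p' t = (\<Sum>q\<le>L. spherical p (L - p) d q t * cnj (spherical p' (L - p') d' q t))"
      for p p' t
    define h where "h t = (\<Sum>p\<le>L. \<Sum>p'\<le>L. u p p' * G p p' t)" for t
    define g where "g x = of_real (1 / sqrt (1 - x\<^sup>2)) * (h (arccos x) * of_real ((sin (arccos x))\<^sup>2))" for x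
    have "continuous_on {0..pi} h"
      unfolding h_def G_def spherical_def cis_conv_exp by (intro continuous_intros)
    note subst = arccos_substitution[OF this, folded g_def]
    have eq: "ip_integrand L (P_monic L d) (P_monic L d') x $$ (n, m) = g x" if "x \<in> {-1<..<1}" for x
      using ip_integrand_entry[OF _ _ nm, of x d d'] that by (simp add: g_def h_def u_def G_def)
    have "((\<lambda>t. \<Sum>p\<le>L. \<Sum>p'\<le>L. u p p' * (G p p' t * of_real ((sin t)\<^sup>2))) has_integral
        (\<Sum>p\<le>L. \<Sum>p'\<le>L. u p p' * 0)) {0..pi}"
      unfolding G_def
      by (intro has_integral_sum has_integral_mult_right spherical_pairing_integral assms finite_atMost) auto
    then have "((\<lambda>t. h t * of_real ((sin t)\<^sup>2)) has_integral 0) {0..pi}"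
      by (simp add: h_def sum_distrib_right mult.assoc)
    then have zero: "integral {0..pi} (\<lambda>t. h t * of_real ((sin t)\<^sup>2)) = 0" by (rule integral_unique)
    have "set_integrable lborel {-1<..<1} (\<lambda>x. ip_integrand L (P_monic L d) (P_monic L d') x $$ (n, m))"
      by (rule iffD2[OF set_integrable_cong[OF refl refl eq] subst(1)])
    moreover have "(LBINT x:{-1<..<1}. ip_integrand L (P_monic L d) (P_monic L d') x $$ (n, m))
        = (LBINT x:{-1<..<1}. g x)"
      by (rule set_lebesgue_integral_cong) (auto simp: eq)
    ultimately show ?thesis unfolding subst(2) zero by simp
  qed
  have "matrix_ip L (P_monic L d) (P_monic L d') = 0\<^sub>m (L + 1) (L + 1)"
    by (rule eq_matI) (auto simp: matrix_ip_def entry)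
  with entry show ?thesis by blast
qed

end
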